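(* Let $p$ be a prime, $q=p^e$, $m,k\ge1$, and let $f\in\mathbb{F}_{q^m}[x_1,\dots,x_k]$ be a polynomial of degree $d\ge1$. Then \[\nu_p\big(N(f=y^q-y)\big)\ge e\Big\lceil\frac{mk}{W_q(d,\mathbb{F}_{q^m}^k)}\Big\rceil,\] where $W_q(d,\mathbb{F}_{q^m}^k)=\max\{S_q(\boldsymbol{t}):\boldsymbol{t}\in[0,q^m-1]^k,\ |\boldsymbol{t}|\le d\}$.
   Context: $N(f=y^q-y)$ denotes the number of $(x_1,\dots,x_k,y)\in\mathbb{F}_{q^m}^{k+1}$ with $f(x_1,\dots,x_k)=y^q-y$; $\nu_p$ is the $p$-adic valuation. For $\boldsymbol{t}=(t_1,\dots,t_k)$, $|\boldsymbol{t}|=\sum t_i$ and $S_q(\boldsymbol{t})=\sum_i S_q(t_i)$, where $S_q(a)$ is the sum of the base-$q$ digits of $a$. *)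

theory Defs
  imports Complex_Main "HOL-Library.FuncSet" "HOL-Library.Poly_Mapping" "HOL-Computational_Algebra.Primes"
begin

text \<open>Multivariate polynomials over a ring 'a: finitely supported maps from monomials
  (finitely supported exponent maps)
  to coefficients.\<close>

definition mon_deg :: "(nat \<Rightarrow>\<^sub>0 nat) \<Rightarrow> nat" where
  "mon_deg t = (\<Sum>i\<in>Poly_Mapping.keys t. Poly_Mapping.lookup t i)"

definition total_degree :: "((nat \<Rightarrow>\<^sub>0 nat) \<Rightarrow>\<^sub>0 'a::zero) \<Rightarrow> nat" where
  "total_degree f = Max (insert 0 (mon_deg ` Poly_Mapping.keys f))"

definition vars_below :: "nat \<Rightarrow> ((nat \<Rightarrow>\<^sub>0 nat) \<Rightarrow>\<^sub>0 'a::zero) \<Rightarrow> bool" where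
  "vars_below k f \<longleftrightarrow> (\<forall>t\<in>Poly_Mapping.keys f. Poly_Mapping.keys t \<subseteq> {..<k})"

definition mpeval :: "((nat \<Rightarrow>\<^sub>0 nat) \<Rightarrow>\<^sub>0 'a::comm_semiring_1) \<Rightarrow> (nat \<Rightarrow> 'a) \<Rightarrow> 'a" where
  "mpeval f x = (\<Sum>t\<in>Poly_Mapping.keys f. Poly_Mapping.lookup f t * (\<Prod>i\<in>Poly_Mapping.keys t. x i ^ Poly_Mapping.lookup t i))"

fun digit_sum :: "nat \<Rightarrow> nat \<Rightarrow> nat" where
  "digit_sum q a = (if q \<le> 1 \<or> a = 0 then 0 else a mod q + digit_sum q (a div q))"

definition N_AS :: "nat \<Rightarrow> nat \<Rightarrow> ((nat \<Rightarrow>\<^sub>0 nat) \<Rightarrow>\<^sub>0 'a::{field,finite}) \<Rightarrow> nat" where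
  "N_AS q k f = card {(x, y). x \<in> PiE {..<k} (\<lambda>_. (UNIV :: 'a set)) \<and> mpeval f x = y ^ q - y}"

definition W_q :: "nat \<Rightarrow> nat \<Rightarrow> nat \<Rightarrow> nat \<Rightarrow> nat" where
  "W_q q m k d = Max {(\<Sum>i<k. digit_sum q (t i)) | t.
      t \<in> PiE {..<k} (\<lambda>_. {0..q^m - 1}) \<and> (\<Sum>i<k. t i) \<le> d}"

end

theory Submission
  imports Defs "HOL-Algebra.Algebraic_Closure_Type" "HOL-Number_Theory.Residues"
begin

text \<open>
  Put \<open>q = p\<^sup>e\<close>, \<open>Q = q\<^sup>m\<close>. By additive Hilbert 90, \<open>f(x) = y\<^sup>q - y\<close> has \<open>q\<close> solutions \<open>y\<close> if \<open>f(x)\<close> has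
  trace \<open>0\<close> over the field with \<open>q\<close> elements, and none otherwise. The points of trace \<open>0\<close> are counted
  modulo a power of \<open>p\<close>, without Gauss sums, in an unramified lift of the field: if \<open>A(x)\<close> is the
  trace of \<open>f(x)\<close> with all coefficients and variables replaced by Teichmueller representatives, then
  \<open>A(x)\<close> raised to the power \<open>(q - 1) p\<^sup>N\<close> is congruent modulo \<open>p\<^sup>N\<close> to the indicator of nonzero trace.
  In its multinomial expansion, only those terms survive summation over \<open>x\<close> whose exponents are all
  divisible by \<open>Q - 1\<close>. A positive multiple of \<open>q\<^sup>m - 1\<close> has base-\<open>q\<close> digit sum at least \<open>m (q - 1)\<close>, and
  digit sums are submultiplicative, which bounds the base-\<open>q\<close> digit sums of the multinomial indices
  multiplied by \<open>p\<^sup>l\<close> for every \<open>l < e\<close>. Adding these \<open>e\<close> bounds, each of them rounded up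
  separately, bounds the base-\<open>p\<close> digit sums, hence by Legendre's formula the \<open>p\<close>-adic valuation of
  the multinomial coefficient.
\<close>

hide_const (open) Divisibility.prime

section \<open>Digit sums\<close>

lemma power_ge_2: "a \<ge> 2 \<Longrightarrow> n \<ge> 1 \<Longrightarrow> a ^ n \<ge> (2 :: nat)"
  using self_le_power[of a n] by simp

declare digit_sum.simps [simp del]

lemma digit_sum_0 [simp]: "digit_sum q 0 = 0"
  by (simp add: digit_sum.simps)

lemma digit_sum_rec: "q \<ge> 2 \<Longrightarrow> digit_sum q a = a mod q + digit_sum q (a div q)"
  by (cases "a = 0") (auto simp: digit_sum.simps[of q a])

lemma digit_sum_less: "q \<ge> 2 \<Longrightarrow> a < q \<Longrightarrow> digit_sum q a = a"
  by (simp add: digit_sum_rec)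

lemma digit_sum_add_mult: "q \<ge> 2 \<Longrightarrow> r < q \<Longrightarrow> digit_sum q (q * a + r) = digit_sum q a + r"
  by (subst digit_sum_rec) auto

lemma digit_sum_mult_base: "q \<ge> 2 \<Longrightarrow> digit_sum q (q * a) = digit_sum q a"
  using digit_sum_add_mult[of q 0 a] by simp

lemma digit_sum_mult_power: "q \<ge> 2 \<Longrightarrow> digit_sum q (q ^ n * a) = digit_sum q a"
  by (induction n) (auto simp: mult.assoc digit_sum_mult_base)

text \<open>Each carry lowers the digit sum by \<open>q - 1\<close>. The induction strips the last
  digits and passes a carry on as a further summand \<open>1\<close>.\<close>

lemma digit_sum_add_le:
  assumes q: "q \<ge> 2"
  shows "digit_sum q (a + b) \<le> digit_sum q a + digit_sum q b"
proof (induction "a + b" arbitrary: a b rule: less_induct)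
  case less
  show ?case
  proof (cases "a = 0 \<or> b = 0")
    case True
    then show ?thesis by auto
  next
    case False
    define a' r b' s where d: "a' = a div q" "r = a mod q" "b' = b div q" "s = b mod q"
    have eq: "a = q * a' + r" "b = q * b' + s" and lt: "r < q" "s < q" using q by (auto simp: d)
    have le: "q * a' \<ge> 2 * a'" "q * b' \<ge> 2 * b'" using q by auto
    have sa: "digit_sum q a = digit_sum q a' + r" "digit_sum q b = digit_sum q b' + s"
      unfolding eq using q lt by (simp_all add: digit_sum_add_mult)
    show ?thesis
    proof (cases "r + s < q")
      case True
      have "a + b = q * (a' + b') + (r + s)" by (simp add: eq algebra_simps)
      then have "digit_sum q (a + b) = digit_sum q (a' + b') + (r + s)"
        using digit_sum_add_mult[OF q True] by simp
      moreover have "a' + b' < a + b" using False le eq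
        by linarith
      ultimately show ?thesis using less[of a' b'] sa by simp
    next
      case F: False
      have "a + b = q * (a' + (b' + 1)) + (r + s - q)" using F by (simp add: eq algebra_simps)
      moreover have "r + s - q < q" using lt by simp
      ultimately have "digit_sum q (a + b) = digit_sum q (a' + (b' + 1)) + (r + s - q)"
        using digit_sum_add_mult[OF q] by metis
      \<comment> \<open>With the carry there are three summands, so the induction hypothesis is
        applied twice.\<close>
      moreover have "a' + (b' + 1) < a + b" "b' + 1 < a + b" using F False le eq q by linarith+
      then have "digit_sum q (a' + (b' + 1)) \<le> digit_sum q a' + (digit_sum q b' + digit_sum q 1)"
        using less[of a' "b' + 1"] less[of b' 1] by linarith
      moreover have "digit_sum q 1 = 1" using q by (simp add: digit_sum_less)
      ultimately show ?thesis using sa F q by linarith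
    qed
  qed
qed

lemma digit_sum_sum_le:
  assumes "q \<ge> 2"
  shows "digit_sum q (\<Sum>i\<in>A. f i) \<le> (\<Sum>i\<in>A. digit_sum q (f i))"
proof (induction A rule: infinite_finite_induct)
  case (insert x A)
  then show ?case using digit_sum_add_le[OF assms, of "f x" "sum f A"] by simp
qed auto

lemma digit_sum_mult_le_mult:
  assumes "q \<ge> 2"
  shows "digit_sum q (c * b) \<le> c * digit_sum q b"
  using digit_sum_sum_le[OF assms, of "\<lambda>_. b" "{..<c}"] by simp

text \<open>The digits \<open>r\<close> of \<open>a\<close> present \<open>a * b\<close> as a sum of
  shifted multiples \<open>r * b\<close>; shifts preserve digit sums, and \<open>r * b\<close> is an
  \<open>r\<close>-fold sum of \<open>b\<close>.\<close>

lemma digit_sum_mult_le: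
  assumes q: "q \<ge> 2"
  shows "digit_sum q (a * b) \<le> digit_sum q a * digit_sum q b"
proof (induction a rule: less_induct)
  case (less a)
  show ?case
  proof (cases "a = 0")
    case False
    define a' r where d: "a' = a div q" "r = a mod q"
    have eq: "a = q * a' + r" and lt: "r < q" using q by (auto simp: d)
    have "a' < a" using False q by (simp add: d)
    have "digit_sum q (a * b) = digit_sum q (q * (a' * b) + r * b)" by (simp add: eq algebra_simps)
    also have "\<dots> \<le> digit_sum q (a' * b) + r * digit_sum q b"
      using digit_sum_add_le[OF q, of "q * (a' * b)" "r * b"] digit_sum_mult_le_mult[OF q, of r b]
        digit_sum_mult_base[OF q, of "a' * b"] by linarith
    also have "\<dots> \<le> digit_sum q a' * digit_sum q b + r * digit_sum q b"
      using less[OF \<open>a' < a\<close>] by simp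
    also have "\<dots> = digit_sum q a * digit_sum q b"
      using digit_sum_rec[OF q, of a] by (simp add: d add_mult_distrib)
    finally show ?thesis .
  qed simp
qed

lemma digit_sum_mod:
  assumes q: "q \<ge> 2"
  shows "[digit_sum q a = a] (mod (q - 1))"
proof (induction a rule: less_induct)
  case (less a)
  show ?case
  proof (cases "a = 0")
    case False
    have "[digit_sum q (a div q) = a div q] (mod (q - 1))" using less[of "a div q"] False q by simp
    moreover have "[q * (a div q) = 1 * (a div q)] (mod (q - 1))"
      by (intro cong_mult cong_refl) (use q in \<open>simp add: cong_altdef_nat\<close>)
    ultimately have "[a mod q + digit_sum q (a div q) = a mod q + q * (a div q)] (mod (q - 1))"
      by (intro cong_add cong_refl) (metis cong_sym cong_trans mult_1)
    then show ?thesis using q by (simp add: digit_sum_rec[of q a] add.commute)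
  qed simp
qed

lemma digit_sum_split_power:
  assumes q: "q \<ge> 2"
  shows "digit_sum q a = digit_sum q (a div q ^ n) + digit_sum q (a mod q ^ n)"
proof (induction n arbitrary: a)
  case (Suc n)
  have "a mod q ^ Suc n = q * (a div q mod q ^ n) + a mod q"
    by (metis power_Suc mod_mult2_eq)
  then have "digit_sum q (a mod q ^ Suc n) = digit_sum q (a div q mod q ^ n) + a mod q"
    using digit_sum_add_mult[OF q, of "a mod q"] q by simp
  then show ?case
    using Suc[of "a div q"] digit_sum_rec[OF q, of a] by (simp add: div_mult2_eq)
qed simp

lemma digit_sum_power_minus_1:
  assumes q: "q \<ge> 2"
  shows "digit_sum q (q ^ m - 1) = m * (q - 1)"
proof (induction m)
  case (Suc m)
  have "q ^ Suc m - 1 = q * (q ^ m - 1) + (q - 1)"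
    using q by (simp add: algebra_simps)
  then have "digit_sum q (q ^ Suc m - 1) = m * (q - 1) + (q - 1)"
    using Suc digit_sum_add_mult[OF q, of "q - 1" "q ^ m - 1"] q by auto
  then show ?case by simp
qed simp

text \<open>As \<open>q ^ m\<close> is 1 modulo \<open>q ^ m - 1\<close>, replacing
  \<open>a = q ^ m * u + v\<close> by \<open>u + v\<close> preserves divisibility, and it does not
  raise the digit sum. The descent ends at \<open>q ^ m - 1\<close>, all of whose \<open>m\<close>
  digits are \<open>q - 1\<close>.\<close>

lemma digit_sum_ge_of_dvd:
  assumes q: "q \<ge> 2" and m: "m \<ge> 1" and "a > 0" "(q ^ m - 1) dvd a"
  shows "m * (q - 1) \<le> digit_sum q a"
  using assms(3,4)
proof (induction a rule: less_induct)
  case (less a)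
  have Q: "q ^ m \<ge> 2" using q m by (simp add: power_ge_2)
  show ?case
  proof (cases "a < q ^ m")
    case True
    then have "a = q ^ m - 1" using less.prems dvd_imp_le[of "q ^ m - 1" a] by simp
    then show ?thesis using digit_sum_power_minus_1[OF q, of m] by simp
  next
    case False
    define u v where d: "u = a div q ^ m" "v = a mod q ^ m"
    have eq: "a = (u + v) + (q ^ m - 1) * u"
    proof -
      have "a = q ^ m * u + v" by (simp add: d)
      moreover have "q ^ m * u = (q ^ m - 1) * u + u" using Q by (simp add: diff_mult_distrib)
      ultimately show ?thesis by simp
    qed
    have "u > 0" using False q by (simp add: d div_greater_zero_iff)
    then have "(q ^ m - 1) * u > 0" using Q by simp
    then have "u + v < a" using eq by linarith
    moreover have "(q ^ m - 1) dvd u + v" using less.prems(2) eq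
      by (metis dvd_add_left_iff dvd_triv_left)
    ultimately have "m * (q - 1) \<le> digit_sum q (u + v)" using less.IH[of "u + v"] \<open>u > 0\<close> by simp
    also have "\<dots> \<le> digit_sum q a"
      using digit_sum_add_le[OF q, of u v] digit_sum_split_power[OF q, of a m] by (simp add: d)
    finally show ?thesis .
  qed
qed

text \<open>No carry occurs: the lowest \<open>c\<close> base-\<open>p\<close> digits of
  \<open>p ^ c * a\<close> are zero, and \<open>c \<le> e\<close> keeps this gap, into which
  \<open>b\<close> fits, inside the last digit of base \<open>p ^ e\<close>.\<close>

lemma digit_sum_power_mult_add:
  assumes p: "p \<ge> 2" and c: "c \<le> e" "e \<ge> 1" and b: "b < p ^ c"
  shows "digit_sum (p ^ e) (p ^ c * a + b) = digit_sum (p ^ e) (p ^ c * a) + b"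
proof -
  have q: "p ^ e \<ge> 2" using p c(2) by (simp add: power_ge_2)
  have pe: "p ^ e = p ^ c * p ^ (e - c)" using c by (simp flip: power_add)
  define a1 a2 where d: "a1 = a div p ^ (e - c)" "a2 = a mod p ^ (e - c)"
  have a: "a = p ^ (e - c) * a1 + a2" and a2: "a2 < p ^ (e - c)" using p by (auto simp: d)
  have "p ^ c * (a2 + 1) \<le> p ^ e" unfolding pe using a2 by (intro mult_left_mono) auto
  then have lt: "p ^ c * a2 + b < p ^ e" using b by simp
  have "p ^ c * a + b = p ^ e * a1 + (p ^ c * a2 + b)" by (simp add: pe a algebra_simps)
  moreover have "p ^ c * a = p ^ e * a1 + p ^ c * a2" by (simp add: pe a algebra_simps)
  moreover have "p ^ c * a2 < p ^ e" using lt by simp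
  ultimately show ?thesis
    using digit_sum_add_mult[OF q lt, of a1] digit_sum_add_mult[OF q, of "p ^ c * a2" a1] by (simp add: add.assoc)
qed

text \<open>This converts base \<open>p ^ e\<close> into base \<open>p\<close>: as \<open>l\<close>
  varies, a base-\<open>p\<close> digit of \<open>a\<close> takes each of the \<open>e\<close>
  positions inside a digit of base \<open>p ^ e\<close> once, so its total weight is
  \<open>1 + p + ... + p ^ (e - 1)\<close>.\<close>

lemma sum_digit_sum_shifts:
  assumes p: "p \<ge> 2" and e: "e \<ge> 1"
  shows "(p - 1) * (\<Sum>l<e. digit_sum (p ^ e) (p ^ l * a)) = (p ^ e - 1) * digit_sum p a"
proof -
  have q: "p ^ e \<ge> 2" using p e by (simp add: power_ge_2)
  define S where "S a = (\<Sum>l<e. digit_sum (p ^ e) (p ^ l * a))" for a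
  have "S a = (\<Sum>l<e. p ^ l) * digit_sum p a"
  proof (induction a rule: less_induct)
    case (less a)
    show ?case
    proof (cases "a = 0")
      case False
      define a' r where d: "a' = a div p" "r = a mod p"
      have eq: "a = p * a' + r" and lt: "r < p" using p by (auto simp: d)
      have "a' < a" using False p by (simp add: d)
      have "digit_sum (p ^ e) (p ^ l * a) = digit_sum (p ^ e) (p ^ Suc l * a') + p ^ l * r" if "l < e" for l
        using digit_sum_power_mult_add[OF p, of "Suc l" e "p ^ l * r" a'] that lt p
        by (simp add: eq algebra_simps)
      then have "S a = (\<Sum>l<e. digit_sum (p ^ e) (p ^ Suc l * a')) + (\<Sum>l<e. p ^ l) * r"
        by (simp add: S_def sum.distrib sum_distrib_right)
      \<comment> \<open>Raising all shifts by one replaces the term \<open>l = 0\<close> by the term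
        \<open>l = e\<close>, which has the same digit sum.\<close>
      also have "(\<Sum>l<e. digit_sum (p ^ e) (p ^ Suc l * a')) + digit_sum (p ^ e) (p ^ 0 * a')
           = S a' + digit_sum (p ^ e) (p ^ e * a')"
        unfolding S_def
        using sum.lessThan_Suc_shift[of "\<lambda>l. digit_sum (p ^ e) (p ^ l * a')" e] by simp
      then have "(\<Sum>l<e. digit_sum (p ^ e) (p ^ Suc l * a')) = S a'"
        using digit_sum_mult_base[OF q] by simp
      finally show ?thesis unfolding less[OF \<open>a' < a\<close>]
        using digit_sum_rec[OF p, of a] by (simp add: d add_mult_distrib2)
    qed (simp add: S_def)
  qed
  moreover have "(p - 1) * (\<Sum>l<n. p ^ l) + 1 = p ^ n" for n
  proof (induction n)
    case (Suc n)
    have "p ^ Suc n = (p - 1) * p ^ n + p ^ n" using p by (cases p) auto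
    then show ?case using Suc by (simp add: distrib_left)
  qed simp
  then have "(p - 1) * (\<Sum>l<e. p ^ l) = p ^ e - 1" by (metis add_diff_cancel_right')
  ultimately show ?thesis by (simp add: S_def flip: mult.assoc)
qed

section \<open>Multinomial coefficients\<close>

lemma legendre_digit_sum:
  fixes p :: nat
  assumes "prime p"
  shows "(p - 1) * multiplicity p (fact n :: nat) + digit_sum p n = n"
proof (induction n)
  case (Suc n)
  have p: "p \<ge> 2" using assms prime_ge_2_nat by blast
  \<comment> \<open>Passing to \<open>Suc n\<close> turns every trailing digit \<open>p - 1\<close>
    of \<open>n\<close> into \<open>0\<close>, at a cost of \<open>p - 1\<close> each, and their
    number is the multiplicity of \<open>p\<close> in \<open>Suc n\<close>.\<close>
  have aux: "digit_sum p n + 1 = digit_sum p (Suc n) + (p - 1) * multiplicity p (Suc n)" for n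
  proof (induction n rule: less_induct)
    case (less n)
    show ?case
    proof (cases "p dvd Suc n")
      case False
      then have "Suc (n mod p) < p" using p
        by (metis mod_Suc mod_eq_0_iff_dvd mod_less_divisor Suc_lessI zero_less_numeral less_le_trans)
      then have "digit_sum p (Suc n) = digit_sum p n + 1"
        using digit_sum_add_mult[OF p, of "Suc (n mod p)" "n div p"] digit_sum_rec[OF p, of n] by simp
      then show ?thesis using False by (simp add: not_dvd_imp_multiplicity_0)
    next
      case True
      then obtain j where j: "Suc n = p * j" by auto
      then have "j > 0" by (cases j) auto
      then obtain i where i: "j = Suc i" using gr0_implies_Suc by blast
      have n: "n = p * i + (p - 1)" using j i p by simp
      then have "i < n" using p by (cases "i = 0") (auto intro: order_less_le_trans[of i "p * i"])
      have "digit_sum p n = digit_sum p i + (p - 1)" unfolding n using p digit_sum_add_mult[OF p, of "p - 1" i] by auto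
      moreover have "digit_sum p (Suc n) = digit_sum p (Suc i)"
        unfolding j i by (rule digit_sum_mult_base[OF p])
      moreover have "multiplicity p (Suc n) = Suc (multiplicity p (Suc i))"
        unfolding j i using assms by (subst multiplicity_times_same) auto
      ultimately show ?thesis using less[OF \<open>i < n\<close>] by simp
    qed
  qed
  have "multiplicity p (fact (Suc n) :: nat) = multiplicity p (Suc n) + multiplicity p (fact n :: nat)"
    using assms by (simp add: prime_elem_multiplicity_mult_distrib del: mult_Suc)
  then show ?case using Suc aux[of n] by (simp add: distrib_left)
qed simp

text \<open>The coefficients are natural numbers pinned down by a product with factorials, so the
  expansion holds without division and their valuation can be read off. One family \<open>c\<close>
  serves all \<open>a\<close>.\<close>

lemma multinomial_expansion:
  assumes "finite I"
  obtains c :: "('i \<Rightarrow> nat) \<Rightarrow> nat" where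
    "\<And>a :: 'i \<Rightarrow> 'r :: comm_semiring_1. (\<Sum>i\<in>I. a i) ^ n =
       (\<Sum>J | J \<in> I \<rightarrow>\<^sub>E {..n} \<and> sum J I = n. of_nat (c J) * (\<Prod>i\<in>I. a i ^ J i))"
    "\<And>J. J \<in> I \<rightarrow>\<^sub>E {..n} \<Longrightarrow> sum J I = n \<Longrightarrow> c J * (\<Prod>i\<in>I. fact (J i)) = fact n"
proof -
  define comps where "comps I n = {J. J \<in> I \<rightarrow>\<^sub>E {..n} \<and> sum J I = n}" for I :: "'i set" and n :: nat
  have "\<exists>c. (\<forall>a :: 'i \<Rightarrow> 'r. (\<Sum>i\<in>I. a i) ^ n = (\<Sum>J\<in>comps I n. of_nat (c J) * (\<Prod>i\<in>I. a i ^ J i))) \<and>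
          (\<forall>J\<in>comps I n. c J * (\<Prod>i\<in>I. fact (J i)) = fact n)"
    using assms
  proof (induction I arbitrary: n)
    case empty
    have "comps {} n = (if n = 0 then {\<lambda>_. undefined} else {})" by (auto simp: comps_def)
    then show ?case by (intro exI[of _ "\<lambda>_. 1"]) (auto simp: power_0_left)
  next
    case (insert x I)
    \<comment> \<open>Splitting off \<open>x\<close> leaves the exponents \<open>n - j\<close>, so
      the coefficients for all \<open>n\<close> are chosen simultaneously.\<close>
    have "\<exists>c. \<forall>n. (\<forall>a :: 'i \<Rightarrow> 'r. (\<Sum>i\<in>I. a i) ^ n = (\<Sum>J\<in>comps I n. of_nat (c n J) * (\<Prod>i\<in>I. a i ^ J i))) \<and>
            (\<forall>J\<in>comps I n. c n J * (\<Prod>i\<in>I. fact (J i)) = fact n)"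
      by (intro choice allI insert.IH)
    then obtain c where c:
      "\<And>n (a :: 'i \<Rightarrow> 'r). (\<Sum>i\<in>I. a i) ^ n = (\<Sum>J\<in>comps I n. of_nat (c n J) * (\<Prod>i\<in>I. a i ^ J i))"
      "\<And>n J. J \<in> comps I n \<Longrightarrow> c n J * (\<Prod>i\<in>I. fact (J i)) = fact n"
      by blast
    define c' where "c' J = (n choose J x) * c (n - J x) (restrict J I)" for J
    have fin: "finite (comps I n)" for n
      by (rule finite_subset[of _ "I \<rightarrow>\<^sub>E {..n}"]) (use insert in \<open>auto simp: comps_def intro: finite_PiE\<close>)
    have rest: "restrict J I \<in> comps I (n - J x)" "J x \<le> n" if "J \<in> comps (insert x I) n" for J
    proof -
      have J: "J \<in> insert x I \<rightarrow>\<^sub>E {..n}" "J x + sum J I = n" using that insert by (auto simp: comps_def)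
      then have "J i \<le> n - J x" if "i \<in> I" for i
        using member_le_sum[of i I J] that insert by auto
      then show "restrict J I \<in> comps I (n - J x)" "J x \<le> n" using J by (auto simp: comps_def)
    qed
    have "(\<Sum>i\<in>insert x I. a i) ^ n = (\<Sum>J\<in>comps (insert x I) n. of_nat (c' J) * (\<Prod>i\<in>insert x I. a i ^ J i))"
      for a :: "'i \<Rightarrow> 'r"
    proof -
      have "(\<Sum>i\<in>insert x I. a i) ^ n = (\<Sum>j\<le>n. of_nat (n choose j) * a x ^ j * (\<Sum>i\<in>I. a i) ^ (n - j))"
        using insert by (simp add: binomial_ring)
      also have "\<dots> = (\<Sum>j\<le>n. \<Sum>J\<in>comps I (n - j). of_nat (n choose j) * a x ^ j * (of_nat (c (n - j) J) * (\<Prod>i\<in>I. a i ^ J i)))"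
        by (subst c(1)) (simp add: sum_distrib_left)
      also have "\<dots> = (\<Sum>(j,J)\<in>Sigma {..n} (\<lambda>j. comps I (n - j)). of_nat (n choose j) * a x ^ j * (of_nat (c (n - j) J) * (\<Prod>i\<in>I. a i ^ J i)))"
        using fin by (subst sum.Sigma) auto
      also have "\<dots> = (\<Sum>J\<in>comps (insert x I) n. of_nat (c' J) * (\<Prod>i\<in>insert x I. a i ^ J i))"
      \<comment> \<open>An index on \<open>insert x I\<close> corresponds to its value at
        \<open>x\<close> together with its restriction to \<open>I\<close>.\<close>
      proof (rule sum.reindex_bij_witness[of _ "\<lambda>J. (J x, restrict J I)" "\<lambda>(j, J). J(x := j)"], goal_cases)
        case (1 z)
        then show ?case using insert by (auto simp: comps_def PiE_def extensional_def restrict_def fun_eq_iff)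
      next
        case (2 z)
        then obtain j J where z: "z = (j, J)" "j \<le> n" "J \<in> I \<rightarrow>\<^sub>E {..n - j}" "sum J I = n - j"
          by (auto simp: comps_def)
        have "sum (J(x := j)) I = sum J I" using insert by (intro sum.cong) auto
        moreover have "J(x := j) \<in> insert x I \<rightarrow>\<^sub>E {..n}"
          using z(2,3) by (auto simp: PiE_iff extensional_def)
        ultimately show ?case using z insert by (simp add: comps_def)
      next
        case (3 J)
        then show ?case using insert
          by (auto simp: comps_def PiE_def extensional_def restrict_def fun_eq_iff)
      next
        case (4 J)
        then show ?case using rest by auto
      next
        case (5 z)
        then obtain j J where z: "z = (j, J)" "j \<le> n" "J \<in> comps I (n - j)"
          by auto
        have "restrict (J(x := j)) I = J"
          using z(3) insert by (auto simp: comps_def PiE_def extensional_def restrict_def fun_eq_iff)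
        moreover have "(\<Prod>i\<in>I. a i ^ (J(x := j)) i) = (\<Prod>i\<in>I. a i ^ J i)"
          using insert by (intro prod.cong) auto
        ultimately show ?case using insert z by (simp add: c'_def mult_ac)
    qed
    finally show ?thesis .
    qed
    moreover have "c' J * (\<Prod>i\<in>insert x I. fact (J i)) = fact n" if "J \<in> comps (insert x I) n" for J
    proof -
      have "c (n - J x) (restrict J I) * (\<Prod>i\<in>I. fact (J i)) = fact (n - J x)"
        using c(2)[OF rest(1)[OF that]] by simp
      then have "c' J * (\<Prod>i\<in>insert x I. fact (J i)) = fact (J x) * fact (n - J x) * (n choose J x)"
        using insert by (simp add: c'_def mult_ac)
      then show ?thesis using binomial_fact_lemma[OF rest(2)[OF that]] by simp
    qed
    ultimately show ?case by blast
  qed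
  then show thesis using that unfolding comps_def by blast
qed

text \<open>Legendre's formula is applied to \<open>n\<close> and to each \<open>J i\<close>; the
  linear terms cancel since the \<open>J i\<close> add up to \<open>n\<close>.\<close>

lemma multiplicity_multinomial:
  fixes p :: nat
  assumes p: "prime p" and I: "finite I" and c: "c * (\<Prod>i\<in>I. fact (J i)) = fact n" and n: "sum J I = n"
  shows "(p - 1) * multiplicity p c + digit_sum p n = (\<Sum>i\<in>I. digit_sum p (J i))"
proof -
  have "c \<noteq> 0" using c by (metis fact_nonzero mult_zero_left)
  then have "multiplicity p (fact n :: nat) = multiplicity p c + (\<Sum>i\<in>I. multiplicity p (fact (J i) :: nat))"
    unfolding c[symmetric] using p I
    by (subst prime_elem_multiplicity_mult_distrib, simp_all) (subst prime_elem_multiplicity_prod_distrib, auto)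
  moreover have "(\<Sum>i\<in>I. (p - 1) * multiplicity p (fact (J i) :: nat) + digit_sum p (J i)) = n"
    using n legendre_digit_sum[OF p] by simp
  ultimately show ?thesis using legendre_digit_sum[OF p, of n]
    by (simp add: sum.distrib distrib_left flip: sum_distrib_left)
qed

section \<open>Finite fields\<close>

lemma CHAR_eq_of_card:
  assumes "prime p" "card (UNIV :: 'a::{field,finite} set) = p ^ r"
  shows "CHAR('a) = p"
proof -
  have "prime CHAR('a)" using prime_CHAR_semidom[where 'a='a] finite_imp_CHAR_pos[where 'a='a] by simp
  moreover have "CHAR('a) dvd p ^ r" using CHAR_dvd_CARD[where 'a='a] assms by simp
  ultimately show ?thesis using assms(1) by (metis prime_dvd_power primes_dvd_imp_eq)
qed

text \<open>Cyclicity of the multiplicative group, transported from carrier-based fields to the type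
  class. Evaluation at this generator becomes the residue map of the lift.\<close>

lemma finite_field_generator:
  obtains g :: "'a::{field,finite}" where "\<And>x. x \<noteq> 0 \<Longrightarrow> \<exists>n::nat. x = g ^ n"
proof -
  let ?R = "ring_of_type_algebra :: 'a ring"
  have mult_one: "a \<otimes>\<^bsub>?R\<^esub> b = a * b" "\<one>\<^bsub>?R\<^esub> = 1" for a b
    by (simp_all add: ring_of_type_algebra_def)
  have fin: "finite (carrier ?R)" and carrier: "carrier (Multiplicative_Group.mult_of ?R) = UNIV - {0}"
    by (simp_all add: ring_of_type_algebra_def)
  interpret field ?R by (rule field_from_type_algebra)
  have pow: "x [^]\<^bsub>?R\<^esub> n = x ^ n" for x :: 'a and n :: nat
    by (induction n) (simp_all only: nat_pow_0 nat_pow_Suc mult_one power_0 power_Suc2)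
  from finite_field_mult_group_has_gen[OF fin] obtain g
    where "carrier (Multiplicative_Group.mult_of ?R) = {g [^]\<^bsub>?R\<^esub> i | i::nat. i \<in> UNIV}" by blast
  then have "UNIV - {0} = {g ^ i | i::nat. True}" unfolding carrier pow by blast
  then have "\<exists>n::nat. x = g ^ n" if "x \<noteq> 0" for x using that by blast
  then show thesis using that by blast
qed

text \<open>Multiplication by \<open>x\<close> permutes the nonzero elements, so it fixes their
  product.\<close>

lemma power_card_minus_1:
  fixes x :: "'a::{field,finite}"
  assumes "x \<noteq> 0"
  shows "x ^ (card (UNIV :: 'a set) - 1) = 1"
proof -
  let ?P = "\<Prod>(UNIV - {0 :: 'a})"
  have "?P = (\<Prod>y\<in>UNIV - {0}. x * y)"
    by (rule prod.reindex_bij_witness[of _ "\<lambda>y. x * y" "\<lambda>y. y / x"]) (use assms in auto)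
  also have "\<dots> = x ^ (card (UNIV :: 'a set) - 1) * ?P"
    by (simp add: prod.distrib card_Diff_singleton)
  finally show ?thesis by simp
qed

lemma card_field_gt_1: "card (UNIV :: 'a::{field,finite} set) > 1"
  using card_mono[of "UNIV :: 'a set" "{0, 1}"] by simp

lemma power_card_eq:
  fixes x :: "'a::{field,finite}"
  shows "x ^ card (UNIV :: 'a set) = x"
proof (cases "x = 0")
  case False
  have "x ^ Suc (card (UNIV :: 'a set) - 1) = x" using power_card_minus_1[OF False] by simp
  then show ?thesis using card_field_gt_1[where 'a='a] by simp
qed (use card_field_gt_1[where 'a='a] in auto)

text \<open>The second hypothesis covers \<open>x = 0\<close>, where the exponent \<open>0\<close>
  gives \<open>1\<close> and every other exponent gives \<open>0\<close>.\<close>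

lemma power_cong_exponent:
  fixes x :: "'a::{field,finite}"
  assumes "[a = b] (mod (card (UNIV :: 'a set) - 1))" "a = 0 \<longleftrightarrow> b = 0"
  shows "x ^ a = x ^ b"
proof (cases "x = 0")
  case True
  then show ?thesis using assms by (auto simp: power_0_left)
next
  case False
  have *: "x ^ n = x ^ (n mod (card (UNIV :: 'a set) - 1))" for n
  proof -
    let ?d = "card (UNIV :: 'a set) - 1"
    have "x ^ n = x ^ (?d * (n div ?d) + n mod ?d)" by (simp only: mult_div_mod_eq)
    also have "\<dots> = x ^ (n mod ?d)"
      by (simp only: power_add power_mult power_card_minus_1[OF False] power_one mult_1)
    finally show ?thesis .
  qed
  show ?thesis using *[of a] *[of b] assms by (simp add: cong_def)
qed

text \<open>Otherwise \<open>X ^ b - 1\<close>, with \<open>b\<close> the residue of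
  \<open>a\<close>, would vanish at all \<open>Q - 1\<close> nonzero elements of a field of size
  \<open>Q\<close>, although \<open>0 < b < Q - 1\<close>.\<close>

lemma exists_power_neq_1:
  assumes "\<not> (card (UNIV :: 'a set) - 1) dvd a"
  obtains g :: "'a::{field,finite}" where "g \<noteq> 0" "g ^ a \<noteq> 1"
proof (rule ccontr)
  let ?Q = "card (UNIV :: 'a set)"
  assume "\<not> thesis"
  then have all: "\<And>g::'a. g \<noteq> 0 \<Longrightarrow> g ^ a = 1" using that by blast
  define b where "b = a mod (?Q - 1)"
  have b: "0 < b" "b < ?Q - 1" using assms card_field_gt_1[where 'a='a]
    by (auto simp: b_def dvd_eq_mod_eq_0)
  have "g ^ b = 1" if "g \<noteq> 0" for g :: 'a
    using power_cong_exponent[of a b g] all[OF that] b assms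
    by (metis b_def cong_mod_right cong_refl dvd_0_right less_numeral_extra(3))
  then have sub: "UNIV - {0} \<subseteq> {x :: 'a. poly (Polynomial.monom 1 b - 1) x = 0}"
    by (auto simp: poly_monom)
  have deg: "Polynomial.degree (Polynomial.monom 1 b - 1 :: 'a poly) \<le> b"
    by (intro degree_diff_le) (auto intro: degree_monom_le)
  have "Polynomial.coeff (Polynomial.monom 1 b - 1 :: 'a poly) b = 1" using b by simp
  then have ne: "Polynomial.monom 1 b - 1 \<noteq> (0 :: 'a poly)" by (metis coeff_0 zero_neq_one)
  have "?Q - 1 \<le> card {x :: 'a. poly (Polynomial.monom 1 b - 1) x = 0}"
    using card_mono[OF _ sub] by (simp add: card_Diff_singleton)
  then show False using card_poly_roots_bound[OF ne] deg b by linarith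
qed

section \<open>Lifting to characteristic zero\<close>

text \<open>\<open>D M a\<close> plays the role of divisibility by \<open>p ^ M\<close> in the ring of integers of an unramified
  extension of the \<open>p\<close>-adic numbers with residue map \<open>\<phi>\<close>.\<close>

locale unramified_lift =
  fixes p r :: nat and D :: "nat \<Rightarrow> 'r::comm_ring_1 \<Rightarrow> bool" and \<phi> :: "'r \<Rightarrow> 'a::{field,finite}"
  assumes prime_p: "prime p"
    and card_field: "card (UNIV :: 'a set) = p ^ r"
    and D_0: "D 0 a"
    and D_zero: "D M 0"
    and D_add: "D M a \<Longrightarrow> D M b \<Longrightarrow> D M (a + b)"
    and D_mult: "D M a \<Longrightarrow> D N b \<Longrightarrow> D (M + N) (a * b)"
    and D_Suc: "D (Suc M) a \<Longrightarrow> D M a"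
    and D_power_p: "D M (of_nat (p ^ M))"
    and D_of_int: "D M (of_int n) \<Longrightarrow> int (p ^ M) dvd n"
    and D_1_iff: "D 1 a \<longleftrightarrow> \<phi> a = 0"
    and \<phi>_add: "\<phi> (a + b) = \<phi> a + \<phi> b"
    and \<phi>_mult: "\<phi> (a * b) = \<phi> a * \<phi> b"
    and \<phi>_1: "\<phi> 1 = 1"
    and surj_\<phi>: "surj \<phi>"
begin

section \<open>Arithmetic of an unramified lift\<close>

lemma \<phi>_0: "\<phi> 0 = 0"
  using \<phi>_add[of 0 0] by (metis add.right_neutral add_left_imp_eq)

lemma \<phi>_uminus: "\<phi> (- a) = - \<phi> a"
  using \<phi>_add[of a "- a"] \<phi>_0 by (simp add: eq_neg_iff_add_eq_0 add.commute)

lemma \<phi>_diff: "\<phi> (a - b) = \<phi> a - \<phi> b"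
  using \<phi>_add[of a "- b"] by (simp add: \<phi>_uminus)

lemma \<phi>_sum: "\<phi> (sum f A) = (\<Sum>x\<in>A. \<phi> (f x))"
  by (induction A rule: infinite_finite_induct) (auto simp: \<phi>_0 \<phi>_add)

lemma \<phi>_power: "\<phi> (a ^ n) = \<phi> a ^ n"
  by (induction n) (auto simp: \<phi>_1 \<phi>_mult)

lemma \<phi>_prod: "\<phi> (prod f A) = (\<Prod>x\<in>A. \<phi> (f x))"
  by (induction A rule: infinite_finite_induct) (auto simp: \<phi>_1 \<phi>_mult)

lemma D_mult_left: "D M b \<Longrightarrow> D M (a * b)"
  using D_mult[OF D_0, of M b a] by simp

lemma D_mult_right: "D M a \<Longrightarrow> D M (a * b)"
  using D_mult_left[of M a b] by (simp add: mult.commute)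

lemma D_uminus: "D M a \<Longrightarrow> D M (- a)"
  using D_mult_left[of M a "-1"] by simp

lemma D_diff: "D M a \<Longrightarrow> D M b \<Longrightarrow> D M (a - b)"
  using D_add[of M a "- b"] D_uminus[of M b] by simp

lemma D_sum: "(\<And>x. x \<in> A \<Longrightarrow> D M (f x)) \<Longrightarrow> D M (sum f A)"
  by (induction A rule: infinite_finite_induct) (auto simp: D_zero D_add)

lemma D_mono: "M \<le> N \<Longrightarrow> D N a \<Longrightarrow> D M a"
  by (induction rule: dec_induct) (auto dest: D_Suc)

lemma D_power: "D M a \<Longrightarrow> D (n * M) (a ^ n)"
  by (induction n) (auto simp: D_0 D_mult)

lemma D_prod: "finite A \<Longrightarrow> (\<And>x. x \<in> A \<Longrightarrow> D (M x) (f x)) \<Longrightarrow> D (sum M A) (prod f A)"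
  by (induction A rule: finite_induct) (auto simp: D_0 D_mult)

lemma D_power_diff: "D M (a - b) \<Longrightarrow> D M (a ^ n - b ^ n)"
  unfolding power_diff_sumr2 by (rule D_mult_right)

text \<open>The cofactor of \<open>a - b\<close> in \<open>a ^ p - b ^ p\<close> is a sum of
  \<open>p\<close> terms with equal residues, so its residue is \<open>0\<close> and it supplies one
  more factor \<open>p\<close>.\<close>

lemma D_power_prime_diff:
  assumes "M \<ge> 1" "D M (a - b)"
  shows "D (Suc M) (a ^ p - b ^ p)"
proof -
  have "\<phi> a = \<phi> b" using D_mono[OF assms] unfolding D_1_iff by (simp add: \<phi>_diff)
  then have "\<phi> (\<Sum>i<p. b ^ (p - Suc i) * a ^ i) = (\<Sum>i<p. \<phi> b ^ (p - 1))"
    by (simp add: \<phi>_sum \<phi>_mult \<phi>_power flip: power_add)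
  also have "\<dots> = 0" using CHAR_eq_of_card[OF prime_p card_field] of_nat_CHAR[where 'a='a] by simp
  finally have "D 1 (\<Sum>i<p. b ^ (p - Suc i) * a ^ i)" by (simp only: D_1_iff)
  from D_mult[OF assms(2) this] show ?thesis by (simp add: power_diff_sumr2)
qed

text \<open>A \<open>p ^ N\<close>-th power depends, modulo \<open>p ^ (N + 1)\<close>, only on the
  residue. Both the Teichmueller representatives and the indicator of nonzero trace rest on
  this.\<close>

lemma D_power_prime_power_diff:
  assumes "\<phi> a = \<phi> b"
  shows "D (Suc N) (a ^ (p ^ N) - b ^ (p ^ N))"
proof (induction N)
  case 0
  then show ?case using assms D_1_iff[of "a - b"] by (simp add: \<phi>_diff)
next
  case (Suc N)
  then show ?case using D_power_prime_diff[OF _ Suc] by (simp add: power_mult mult.commute flip: power_mult)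
qed

text \<open>With \<open>w\<close> inverse to \<open>u\<close> on residues,
  \<open>a = (1 - w * u) * a + w * (u * a)\<close>; the factor \<open>1 - w * u\<close> gains one
  power of \<open>p\<close> per round, up to \<open>M\<close>.\<close>

lemma D_cancel_unit:
  assumes "\<phi> u \<noteq> 0" "D M (u * a)"
  shows "D M a"
proof -
  obtain w where w: "\<phi> w = inverse (\<phi> u)" using surj_\<phi> by (metis surjD)
  have D1: "D 1 (1 - w * u)" using assms(1) by (simp only: D_1_iff \<phi>_diff \<phi>_mult w \<phi>_1) simp
  have "j \<le> M \<Longrightarrow> D j a" for j
  proof (induction j)
    case (Suc j)
    have "D (1 + j) ((1 - w * u) * a)" using Suc D1 by (intro D_mult) auto
    moreover have "D (1 + j) (w * (u * a))" using D_mult_left[OF D_mono[OF _ assms(2)], of "1 + j" w] Suc by simp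
    ultimately have "D (1 + j) ((1 - w * u) * a + w * (u * a))" by (rule D_add)
    moreover have "(1 - w * u) * a + w * (u * a) = a" by (simp add: algebra_simps)
    ultimately have "D (1 + j) a" by (simp only:)
    then show ?case by simp
  qed (simp add: D_0)
  then show ?thesis by simp
qed

text \<open>Teichmueller representatives to finite precision \<open>M\<close>: a power of an
  arbitrary lift. The exponent is a power of \<open>p ^ r\<close>, so the residue stays
  \<open>x\<close>. The value \<open>0\<close> at \<open>0\<close> makes products with a zero factor
  agree exactly.\<close>

definition teich :: "nat \<Rightarrow> 'a \<Rightarrow> 'r" where
  "teich M x = (if x = 0 then 0 else inv_into UNIV \<phi> x ^ ((p ^ r) ^ M))"

lemma \<phi>_teich: "\<phi> (teich M x) = x"
proof -
  have "x ^ ((p ^ r) ^ M) = x" using power_card_eq[of x] unfolding card_field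
    by (induction M) (auto simp: power_mult)
  then show ?thesis using surj_\<phi> by (simp add: teich_def \<phi>_0 \<phi>_power surj_f_inv_f)
qed

lemma r_pos: "r \<ge> 1"
  using card_field card_field_gt_1[where 'a='a] by (cases r) auto

lemma teich_mult: "D M (teich M (x * y) - teich M x * teich M y)"
proof (cases "x = 0 \<or> y = 0")
  case True
  then show ?thesis by (auto simp: teich_def D_zero)
next
  case False
  have "\<phi> (inv_into UNIV \<phi> (x * y)) = \<phi> (inv_into UNIV \<phi> x * inv_into UNIV \<phi> y)" using surj_\<phi> by (simp add: \<phi>_mult surj_f_inv_f)
  from D_power_prime_power_diff[OF this, of "r * M"]
  have "D (Suc (r * M)) (teich M (x * y) - teich M x * teich M y)"
    using False by (simp add: teich_def power_mult_distrib power_mult)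
  then show ?thesis by (rule D_mono[rotated]) (use r_pos in \<open>auto intro: le_SucI\<close>)
qed

text \<open>Substituting \<open>g * x\<close> for \<open>x\<close> multiplies the sum by
  \<open>teich M g ^ a\<close> modulo \<open>p ^ M\<close>, and \<open>1 - teich M g ^ a\<close> is
  a unit if \<open>g ^ a\<close> differs from \<open>1\<close>.\<close>

lemma D_sum_teich_power:
  assumes "\<not> (p ^ r - 1) dvd a"
  shows "D M (\<Sum>x\<in>UNIV. teich M x ^ a)"
proof -
  obtain g :: 'a where g: "g \<noteq> 0" "g ^ a \<noteq> 1" using exists_power_neq_1[of a] assms card_field by metis
  let ?S = "\<Sum>x\<in>UNIV. teich M x ^ a"
  have "?S = (\<Sum>x\<in>UNIV. teich M (g * x) ^ a)"
    by (rule sum.reindex_bij_witness[of _ "\<lambda>x. g * x" "\<lambda>x. x / g"]) (use g in auto)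
  moreover have "D M (\<Sum>x\<in>UNIV. (teich M (g * x) ^ a - (teich M g * teich M x) ^ a))"
    by (intro D_sum D_power_diff teich_mult)
  ultimately have "D M (?S - (\<Sum>x\<in>UNIV. (teich M g * teich M x) ^ a))"
    by (simp only: sum_subtractf)
  then have "D M (?S - teich M g ^ a * ?S)"
    by (simp add: power_mult_distrib sum_distrib_left)
  then have "D M ((1 - teich M g ^ a) * ?S)" by (simp add: algebra_simps)
  then show ?thesis by (rule D_cancel_unit[rotated]) (use g in \<open>simp add: \<phi>_diff \<phi>_1 \<phi>_power \<phi>_teich\<close>)
qed

text \<open>The sum factors over the variables. An exponent \<open>0\<close> contributes the field
  size \<open>p ^ r\<close>, and a single exponent not divisible by \<open>p ^ r - 1\<close> already
  gives divisibility by \<open>p ^ M\<close>.\<close>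

lemma D_sum_teich_monomial:
  fixes k :: nat
  assumes "(\<And>i. i < k \<Longrightarrow> (p ^ r - 1) dvd b i) \<Longrightarrow> E \<le> r * card {i. i < k \<and> b i = 0}" "E \<le> M"
  shows "D E (\<Sum>x\<in>PiE {..<k} (\<lambda>_. UNIV). \<Prod>i<k. teich M (x i) ^ b i)"
proof -
  have eq: "(\<Sum>x\<in>PiE {..<k} (\<lambda>_. UNIV). \<Prod>i<k. teich M (x i) ^ b i) = (\<Prod>i<k. \<Sum>y\<in>UNIV. teich M y ^ b i)"
    by (rule prod_sum_PiE[symmetric]) auto
  show ?thesis
  proof (cases "\<forall>i<k. (p ^ r - 1) dvd b i")
    case True
    have "D (if b i = 0 then r else 0) (\<Sum>y\<in>UNIV. teich M y ^ b i)" for i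
      using D_power_p[of r] by (simp add: D_0 card_field)
    then have "D (\<Sum>i<k. if b i = 0 then r else 0) (\<Prod>i<k. \<Sum>y\<in>UNIV. teich M y ^ b i)"
      by (intro D_prod) auto
    moreover have "(\<Sum>i<k. if b i = 0 then r else 0) = r * card {i. i < k \<and> b i = 0}"
      by (simp add: sum.If_cases Int_def)
    ultimately show ?thesis unfolding eq using assms(1) True by (auto intro: D_mono)
  next
    case False
    then obtain i where i: "i < k" "\<not> (p ^ r - 1) dvd b i" by blast
    have "D M (\<Prod>i<k. \<Sum>y\<in>UNIV. teich M y ^ b i)"
      using i D_sum_teich_power[OF i(2)] by (subst prod.remove[of _ i]) (auto intro: D_mult_right)
    then show ?thesis unfolding eq using assms(2) by (rule D_mono[rotated])
  qed
qed

end

text \<open>\<open>D M\<close> is membership in the ideal of \<open>\<int>[X]\<close> generated by \<open>p ^ M\<close> and a monic lift \<open>h\<close> of the minimal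
  polynomial of a generator \<open>g\<close> of the multiplicative group. Taking \<open>h\<close> monic of least degree with
  \<open>h(g) = 0\<close> makes the kernel of evaluation at \<open>g\<close> equal to the ideal generated by \<open>p\<close> and \<open>h\<close>.\<close>

lemma exists_unramified_lift:
  assumes p: "prime p" and card: "card (UNIV :: 'a::{field,finite} set) = p ^ r"
  obtains D :: "nat \<Rightarrow> int poly \<Rightarrow> bool" and \<phi> :: "int poly \<Rightarrow> 'a::{field,finite}" where "unramified_lift p r D \<phi>"
proof -
  obtain g :: 'a where g: "\<And>x. x \<noteq> 0 \<Longrightarrow> \<exists>n::nat. x = g ^ n" using finite_field_generator by metis
  define \<phi> :: "int poly \<Rightarrow> 'a" where "\<phi> a = poly (map_poly of_int a) g" for a
  have \<phi>_0: "\<phi> 0 = 0" by (simp add: \<phi>_def)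
  have \<phi>_pCons: "\<phi> (pCons c a) = of_int c + g * \<phi> a" for c a
    by (simp add: \<phi>_def map_poly_pCons)
  have \<phi>_add: "\<phi> (a + b) = \<phi> a + \<phi> b" for a b
    by (induction a b rule: poly_induct2) (simp_all add: \<phi>_0 \<phi>_pCons algebra_simps)
  have \<phi>_smult: "\<phi> (Polynomial.smult c a) = of_int c * \<phi> a" for c a
    by (induction a) (simp_all add: \<phi>_0 \<phi>_pCons algebra_simps)
  have \<phi>_mult: "\<phi> (a * b) = \<phi> a * \<phi> b" for a b
    by (induction a) (simp_all add: \<phi>_0 \<phi>_pCons \<phi>_add \<phi>_smult algebra_simps)
  have \<phi>_1: "\<phi> 1 = 1" by (simp add: \<phi>_def)
  have \<phi>_uminus: "\<phi> (- a) = - \<phi> a" for a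
    using \<phi>_smult[of "-1" a] by simp
  have \<phi>_diff: "\<phi> (a - b) = \<phi> a - \<phi> b" for a b
    using \<phi>_add[of a "- b"] by (simp add: \<phi>_uminus)
  have \<phi>_monom: "\<phi> (Polynomial.monom 1 n) = g ^ n" for n
    by (simp add: \<phi>_def map_poly_monom poly_monom)
  have p0: "of_nat p = (0 :: 'a)" using CHAR_eq_of_card[OF p card] of_nat_CHAR[where 'a='a] by simp

  define P where "P n \<longleftrightarrow> (\<exists>h. lead_coeff h = 1 \<and> Polynomial.degree h = n \<and> \<phi> h = 0)" for n
  \<comment> \<open>The witness is \<open>X ^ Q - X\<close> for the field size
    \<open>Q\<close>.\<close>
  have "P (card (UNIV :: 'a set))"
  proof -
    let ?n = "card (UNIV :: 'a set)"
    let ?h = "Polynomial.monom 1 ?n - Polynomial.monom 1 1 :: int poly"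
    have "Polynomial.degree ?h = ?n"
    proof (rule antisym)
      show "Polynomial.degree ?h \<le> ?n"
        using card_field_gt_1[where 'a='a] by (intro degree_diff_le) (auto simp: degree_monom_eq)
      show "?n \<le> Polynomial.degree ?h"
        using card_field_gt_1[where 'a='a] by (intro le_degree) auto
    qed
    moreover from this have "lead_coeff ?h = 1" using card_field_gt_1[where 'a='a] by simp
    moreover have "\<phi> ?h = 0" by (simp only: \<phi>_diff \<phi>_monom power_card_eq power_one_right) simp
    ultimately show ?thesis unfolding P_def by blast
  qed
  then obtain n where "P n" and min: "\<And>m. m < n \<Longrightarrow> \<not> P m" by (metis LeastI not_less_Least)
  then obtain h where h: "lead_coeff h = 1" "Polynomial.degree h = n" "\<phi> h = 0" unfolding P_def by blast
  have h0: "h \<noteq> 0" using h(1) by auto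
  have n: "n > 0"
  proof (rule ccontr)
    assume "\<not> n > 0"
    then have "h = 1" using h by (metis degree_eq_zeroE gr0I lead_coeff_pCons(2) one_pCons)
    then show False using h \<phi>_1 by simp
  qed
  \<comment> \<open>Pseudo-division by \<open>h\<close> is true division because \<open>h\<close> is
    monic.\<close>
  have division: "\<exists>s t. a = h * s + t \<and> (t = 0 \<or> Polynomial.degree t < n)" for a
    using pseudo_divmod[OF h0, of a "fst (pseudo_divmod a h)" "snd (pseudo_divmod a h)"] h by auto
  have small: "\<exists>t'. t = Polynomial.smult (int p) t'" if t: "\<phi> t = 0" "Polynomial.degree t < n" for t
  proof -
    have "\<forall>i. int p dvd Polynomial.coeff t i"
    proof (rule ccontr)
      let ?A = "{i. \<not> int p dvd Polynomial.coeff t i}"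
      assume "\<not> (\<forall>i. int p dvd Polynomial.coeff t i)"
      then have ne: "?A \<noteq> {}" by auto
      have sub: "?A \<subseteq> {..Polynomial.degree t}" by (auto intro: le_degree)
      then have fin: "finite ?A" by (rule finite_subset) simp
      define j where "j = Max ?A"
      have j: "\<not> int p dvd Polynomial.coeff t j" "j < n"
        using Max_in[OF fin ne] sub t(2) by (auto simp: j_def)
      have above: "int p dvd Polynomial.coeff t i" if "i > j" for i
        using Max_ge[OF fin, of i] that by (auto simp: j_def)
      have "coprime (Polynomial.coeff t j) (int p)"
        using j(1) p by (metis coprime_commute prime_imp_coprime prime_nat_int_transfer)
      then obtain c where c: "[Polynomial.coeff t j * c = 1] (mod (int p))"
        using cong_solve_coprime_int by blast
      \<comment> \<open>If \<open>p\<close> did not divide \<open>t\<close>, cutting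
        \<open>t\<close> above its last coefficient prime to \<open>p\<close>, scaling by
        \<open>c\<close> and making the leading coefficient exactly \<open>1\<close> would give a
        monic kernel element of degree below \<open>n\<close>.\<close>
      define h' where "h' = (\<Sum>i<j. Polynomial.monom (c * Polynomial.coeff t i) i) + Polynomial.monom 1 j"
      have coeff_h': "Polynomial.coeff h' i = (if i < j then c * Polynomial.coeff t i else if i = j then 1 else 0)" for i
        by (auto simp: h'_def coeff_sum)
      have dvd: "int p dvd Polynomial.coeff (Polynomial.smult c t - h') i" for i
        using above[of i] c by (auto simp: coeff_h' cong_iff_dvd_diff mult.commute)
      then have "[:int p:] dvd Polynomial.smult c t - h'" by (simp add: const_poly_dvd_iff)
      then obtain v where "Polynomial.smult c t - h' = [:int p:] * v" by (rule dvdE)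
      then have "\<phi> (Polynomial.smult c t - h') = \<phi> (Polynomial.smult (int p) v)" by simp
      then have "\<phi> (Polynomial.smult c t) - \<phi> h' = 0" by (simp add: \<phi>_smult \<phi>_diff p0)
      then have "\<phi> h' = 0" by (simp add: \<phi>_smult t)
      moreover have "Polynomial.degree h' = j"
        by (rule antisym[OF degree_le le_degree]) (auto simp: coeff_h')
      ultimately have "P j" unfolding P_def by (intro exI[of _ h']) (simp add: coeff_h')
      then show False using min[OF j(2)] by simp
    qed
    then have "[:int p:] dvd t" by (simp add: const_poly_dvd_iff)
    then show ?thesis by (auto elim!: dvdE)
  qed

  define D where "D M a \<longleftrightarrow> (\<exists>u v. a = Polynomial.smult (int p ^ M) u + h * v)" for M a
  have "unramified_lift p r D \<phi>"
  proof (unfold_locales, goal_cases)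
    case 1 show ?case by fact
  next
    case 2 show ?case by fact
  next
    case (3 a)
    have "a = Polynomial.smult (int p ^ 0) a + h * 0" by simp
    then show ?case unfolding D_def by blast
  next
    case (4 M)
    have "0 = Polynomial.smult (int p ^ M) 0 + h * 0" by simp
    then show ?case unfolding D_def by blast
  next
    case (5 M a b)
    then obtain u v u' v' where "a = Polynomial.smult (int p ^ M) u + h * v" "b = Polynomial.smult (int p ^ M) u' + h * v'"
      unfolding D_def by blast
    then have "a + b = Polynomial.smult (int p ^ M) (u + u') + h * (v + v')"
      by (simp add: smult_add_right algebra_simps)
    then show ?case unfolding D_def by blast
  next
    case (6 M a N b)
    then obtain u v u' v' where ab: "a = Polynomial.smult (int p ^ M) u + h * v" "b = Polynomial.smult (int p ^ N) u' + h * v'"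
      unfolding D_def by blast
    have "a * b = Polynomial.smult (int p ^ (M + N)) (u * u') + h * (v * b + Polynomial.smult (int p ^ M) u * v')"
      by (simp add: ab algebra_simps power_add)
    then show ?case unfolding D_def by blast
  next
    case (7 M a)
    then obtain u v where "a = Polynomial.smult (int p ^ Suc M) u + h * v" unfolding D_def by blast
    then have "a = Polynomial.smult (int p ^ M) (Polynomial.smult (int p) u) + h * v" by (simp add: mult.commute)
    then show ?case unfolding D_def by blast
  next
    case (8 M)
    have "of_nat (p ^ M) = Polynomial.smult (int p ^ M) 1 + h * 0"
      by (simp add: of_nat_poly)
    then show ?case unfolding D_def by blast
  next
    case (9 M a)
    then obtain u v where uv: "of_int a = Polynomial.smult (int p ^ M) u + h * v" unfolding D_def by blast
    obtain s t where st: "u = h * s + t" "t = 0 \<or> Polynomial.degree t < n" using division by blast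
    \<comment> \<open>A constant and a remainder both have degree below \<open>n\<close>, so their
      difference \<open>d\<close>, being a multiple of \<open>h\<close>, vanishes.\<close>
    define d where "d = of_int a - Polynomial.smult (int p ^ M) t"
    have eq: "d = h * (v + Polynomial.smult (int p ^ M) s)"
      unfolding d_def uv st(1) by (simp add: algebra_simps smult_add_right)
    have "Polynomial.degree d < n"
      unfolding d_def using st(2) n
      by (intro degree_diff_less) (auto simp: of_int_poly intro: le_less_trans[OF degree_smult_le])
    then have "v + Polynomial.smult (int p ^ M) s = 0"
      using eq degree_mult_eq[OF h0, of "v + Polynomial.smult (int p ^ M) s"] h(2) by (metis not_add_less1)
    then have "of_int a = Polynomial.smult (int p ^ M) t" using eq by (simp add: d_def)
    then have "Polynomial.coeff (of_int a) 0 = Polynomial.coeff (Polynomial.smult (int p ^ M) t) 0"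
      by (rule arg_cong)
    then have "a = int p ^ M * Polynomial.coeff t 0" by (simp add: of_int_poly)
    then show ?case by simp
  next
    case (10 a)
    show ?case
    proof
      assume "D 1 a"
      then show "\<phi> a = 0" unfolding D_def by (auto simp: \<phi>_add \<phi>_mult \<phi>_smult h p0)
    next
      assume a: "\<phi> a = 0"
      obtain s t where st: "a = h * s + t" "t = 0 \<or> Polynomial.degree t < n" using division by blast
      have "\<phi> t = 0" using a st(1) by (simp add: \<phi>_add \<phi>_mult h)
      then obtain t' where "t = Polynomial.smult (int p) t'"
        using small[of t] st(2) by (metis smult_0_right)
      then have "a = Polynomial.smult (int p ^ 1) t' + h * s" using st(1) by simp
      then show "D 1 a" unfolding D_def by blast
    qed
  next
    case (11 a b) show ?case by (rule \<phi>_add)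
  next
    case (12 a b) show ?case by (rule \<phi>_mult)
  next
    case 13 show ?case by (rule \<phi>_1)
  next
    case 14
    have "\<exists>a. x = \<phi> a" for x
      using g[of x] \<phi>_0 \<phi>_monom by (cases "x = 0") metis+
    then show ?case by (auto simp: surj_def)
  qed
  then show thesis by (rule that)
qed

section \<open>Traces and Artin-Schreier equations\<close>

text \<open>In a field with \<open>q ^ m\<close> elements this is the trace to the subfield with
  \<open>q\<close> elements.\<close>

definition trace_sum :: "nat \<Rightarrow> nat \<Rightarrow> 'a::comm_semiring_1 \<Rightarrow> 'a" where
  "trace_sum q m u = (\<Sum>j<m. u ^ (q ^ j))"

text \<open>The \<open>q\<close>-th power map, with \<open>q = p ^ e\<close>, permutes the
  conjugates cyclically, since \<open>u ^ (q ^ m) = u\<close>. Thus a nonzero trace has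
  \<open>(q - 1)\<close>-st power \<open>1\<close>.\<close>

lemma trace_sum_power:
  fixes u :: "'a::{field,finite}"
  assumes p: "prime p" and card: "card (UNIV :: 'a set) = (p ^ e) ^ m"
  shows "trace_sum (p ^ e) m u ^ (p ^ e) = trace_sum (p ^ e) m u"
proof -
  have CHAR: "CHAR('a) = p" using CHAR_eq_of_card[OF p] card by (metis power_mult)
  have "trace_sum (p ^ e) m u ^ (p ^ e) = (\<Sum>j<m. u ^ ((p ^ e) ^ Suc j))"
    unfolding trace_sum_def using p CHAR
    by (subst freshmans_dream_sum'[of _ e]) (auto simp: mult.commute simp flip: power_mult)
  moreover have "(\<Sum>j<m. u ^ ((p ^ e) ^ Suc j)) + u ^ ((p ^ e) ^ 0) = trace_sum (p ^ e) m u + u ^ ((p ^ e) ^ m)"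
    unfolding trace_sum_def
    using sum.lessThan_Suc_shift[of "\<lambda>j. u ^ ((p ^ e) ^ j)" m] by (simp add: add.commute)
  moreover have "u ^ ((p ^ e) ^ m) = u" using power_card_eq[of u] card by simp
  ultimately show ?thesis by simp
qed

text \<open>Additive Hilbert 90 by counting: root bounds give at most \<open>q\<close> elements in
  the kernel of \<open>L\<close> and at most \<open>q ^ (m - 1)\<close> of trace zero. The range of
  \<open>L\<close> has trace zero, and range size times kernel size is \<open>q ^ m\<close>, so all
  bounds are attained.\<close>

lemma card_Artin_Schreier_fiber:
  fixes u :: "'a::{field,finite}"
  assumes p: "prime p" and e: "e \<ge> 1" and m: "m \<ge> 1" and card: "card (UNIV :: 'a set) = (p ^ e) ^ m"
  shows "card {y. u = y ^ (p ^ e) - y} = (if trace_sum (p ^ e) m u = 0 then p ^ e else 0)"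
proof -
  define q where "q = p ^ e"
  have q: "q \<ge> 2" using prime_ge_2_nat[OF p] e by (simp add: power_ge_2 q_def)
  have CHAR: "CHAR('a) = p" using CHAR_eq_of_card[OF p] card by (metis power_mult)
  have frob: "(a + b) ^ (q ^ j) = a ^ (q ^ j) + b ^ (q ^ j)" for a b :: 'a and j
    using freshmans_dream'[of "q ^ j" "e * j" a b] p CHAR by (simp add: q_def power_mult)
  have frob_diff: "(a - b) ^ (q ^ j) = a ^ (q ^ j) - b ^ (q ^ j)" for a b :: 'a and j
    using frob[of "a - b" b j] by (simp add: algebra_simps)
  define L where "L y = y ^ q - y" for y :: 'a
  have L_add: "L (a + b) = L a + L b" for a b using frob[of a b 1] by (simp add: L_def)
  have L_diff: "L (a - b) = L a - L b" for a b using L_add[of "a - b" b] by simp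
  define Z where "Z = {u :: 'a. trace_sum q m u = 0}"
  define K where "K = {y. L y = 0}"
  have card_K: "card K \<le> q"
  proof -
    let ?h = "Polynomial.monom 1 q - Polynomial.monom 1 1 :: 'a poly"
    have "K = {y. poly ?h y = 0}" by (simp add: K_def L_def poly_monom)
    moreover have "Polynomial.coeff ?h q = 1" using q by simp
    then have "?h \<noteq> 0" by (metis coeff_0 zero_neq_one)
    moreover have "Polynomial.degree ?h \<le> q"
      using q by (intro degree_diff_le) (auto simp: degree_monom_eq)
    ultimately show ?thesis using card_poly_roots_bound[of ?h] by simp
  qed
  have card_Z: "card Z \<le> q ^ (m - 1)"
  proof -
    let ?h = "\<Sum>j<m. Polynomial.monom 1 (q ^ j) :: 'a poly"
    have "Z = {y. poly ?h y = 0}" by (simp add: Z_def trace_sum_def poly_sum poly_monom)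
    moreover have "Polynomial.coeff ?h (q ^ (m - 1)) = (\<Sum>j<m. if j = m - 1 then 1 else 0)"
      unfolding coeff_sum coeff_monom using q by (intro sum.cong refl if_cong) auto
    then have "Polynomial.coeff ?h (q ^ (m - 1)) = 1" using m by simp
    then have "?h \<noteq> 0" by (metis coeff_0 zero_neq_one)
    moreover have "Polynomial.degree ?h \<le> q ^ (m - 1)"
      using q by (intro degree_sum_le) (auto simp: degree_monom_eq)
    ultimately show ?thesis using card_poly_roots_bound[of ?h] by simp
  qed
  have sub: "range L \<subseteq> Z"
  proof safe
    fix y
    have "trace_sum q m (L y) = (\<Sum>j<m. y ^ (q ^ Suc j) - y ^ (q ^ j))"
      unfolding trace_sum_def L_def frob_diff by (simp add: power_mult flip: power_mult)
    also have "\<dots> = y ^ (q ^ m) - y ^ (q ^ 0)" by (rule sum_lessThan_telescope)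
    also have "\<dots> = 0" using power_card_eq[of y] card by (simp add: q_def)
    finally show "L y \<in> Z" by (simp add: Z_def)
  qed
  have fiber: "card {y. L y = L y0} = card K" for y0
  proof -
    have "bij_betw (\<lambda>y. y0 + y) K {y. L y = L y0}"
      by (rule bij_betwI[of _ _ _ "\<lambda>y. y - y0"]) (auto simp: K_def L_add L_diff)
    then show ?thesis by (rule bij_betw_same_card[symmetric])
  qed
  have "(\<Sum>y\<in>(UNIV::'a set). 1::nat) = (\<Sum>u\<in>range L. \<Sum>y\<in>{y\<in>UNIV. L y = u}. 1)"
    by (rule sum.image_gen) simp
  also have "\<dots> = (\<Sum>u\<in>range L. card K)"
    by (intro sum.cong) (auto simp: fiber)
  finally have prod: "card (range L) * card K = q ^ (m - 1) * q"
    using m card by (simp add: q_def flip: power_Suc2)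
  have range_le: "card (range L) \<le> q ^ (m - 1)"
    using card_mono[OF _ sub] card_Z by simp
  have K: "card K = q"
  proof (rule ccontr)
    assume "card K \<noteq> q"
    then have "card K < q" using card_K by simp
    then have "card (range L) * card K < q ^ (m - 1) * q"
      using range_le q by (metis mult_le_mono1 mult_less_cancel1 order_le_less_trans zero_less_power less_le_trans zero_less_numeral)
    then show False using prod by simp
  qed
  then have "card (range L) = q ^ (m - 1)" using prod q by simp
  then have Z: "range L = Z" using sub card_Z by (intro card_seteq) auto
  show ?thesis
  proof (cases "u \<in> Z")
    case True
    then obtain y0 where y0: "u = L y0" using Z by blast
    have "{y. u = y ^ (p ^ e) - y} = {y. L y = L y0}" unfolding y0 by (auto simp: L_def q_def)
    then show ?thesis using True K fiber[of y0] by (simp add: Z_def q_def)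
  next
    case False
    then have "{y. u = y ^ (p ^ e) - y} = {}" unfolding Z[symmetric] by (auto simp: L_def q_def)
    then show ?thesis using False by (simp add: Z_def q_def)
  qed
qed

lemma N_AS_eq:
  fixes f :: "(nat \<Rightarrow>\<^sub>0 nat) \<Rightarrow>\<^sub>0 'a::{field,finite}"
  assumes "prime p" "e \<ge> 1" "m \<ge> 1" "card (UNIV :: 'a set) = (p ^ e) ^ m"
  shows "N_AS (p ^ e) k f =
    p ^ e * card {x \<in> PiE {..<k} (\<lambda>_. UNIV). trace_sum (p ^ e) m (mpeval f x) = 0}"
proof -
  let ?X = "PiE {..<k} (\<lambda>_. UNIV :: 'a set)"
  have fin: "finite ?X" by (intro finite_PiE) auto
  have "{(x, y). x \<in> ?X \<and> mpeval f x = y ^ (p ^ e) - y} = Sigma ?X (\<lambda>x. {y. mpeval f x = y ^ (p ^ e) - y})"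
    by auto
  then have "N_AS (p ^ e) k f = (\<Sum>x\<in>?X. card {y. mpeval f x = y ^ (p ^ e) - y})"
    unfolding N_AS_def using fin by simp
  also have "\<dots> = (\<Sum>x\<in>?X. if trace_sum (p ^ e) m (mpeval f x) = 0 then p ^ e else 0)"
    by (simp only: card_Artin_Schreier_fiber[OF assms])
  also have "\<dots> = p ^ e * card {x \<in> ?X. trace_sum (p ^ e) m (mpeval f x) = 0}"
    using fin by (simp add: sum.If_cases Int_def)
  finally show ?thesis .
qed

text \<open>Positive exponents are reduced to \<open>1, ..., Q - 1\<close> and not to
  \<open>0, ..., Q - 2\<close>, because \<open>x ^ 0\<close> and \<open>x ^ (Q - 1)\<close> differ
  at \<open>x = 0\<close>.\<close>

definition reduce_exponent :: "nat \<Rightarrow> nat \<Rightarrow> nat" where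
  "reduce_exponent Q a = (if a = 0 then 0 else (a - 1) mod (Q - 1) + 1)"

lemma reduce_exponent_le: "reduce_exponent Q a \<le> a"
  using mod_less_eq_dividend[of "a - 1" "Q - 1"] by (cases a) (auto simp: reduce_exponent_def)

lemma reduce_exponent_le_minus_1: "Q > 1 \<Longrightarrow> reduce_exponent Q a \<le> Q - 1"
  using mod_less_divisor[of "Q - 1" "a - 1"] by (auto simp: reduce_exponent_def Suc_le_eq)

lemma power_reduce_exponent:
  fixes x :: "'a::{field,finite}"
  shows "x ^ reduce_exponent (card (UNIV :: 'a set)) a = x ^ a"
proof (cases "a = 0")
  case False
  have "[(a - 1) mod (card (UNIV :: 'a set) - 1) + 1 = (a - 1) + 1] (mod (card (UNIV :: 'a set) - 1))"
    by (intro cong_add) auto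
  then show ?thesis using False by (intro power_cong_exponent) (auto simp: reduce_exponent_def)
qed (simp add: reduce_exponent_def)

lemma mpeval_reduce:
  fixes f :: "(nat \<Rightarrow>\<^sub>0 nat) \<Rightarrow>\<^sub>0 'a::{field,finite}"
  assumes "vars_below k f"
  shows "mpeval f x = (\<Sum>t\<in>Poly_Mapping.keys f. Poly_Mapping.lookup f t *
    (\<Prod>i<k. x i ^ reduce_exponent (card (UNIV :: 'a set)) (Poly_Mapping.lookup t i)))"
  unfolding mpeval_def power_reduce_exponent
proof (intro sum.cong refl arg_cong2[of _ _ _ _ "(*)"])
  fix t assume "t \<in> Poly_Mapping.keys f"
  then have "Poly_Mapping.keys t \<subseteq> {..<k}" using assms by (simp add: vars_below_def)
  then show "(\<Prod>i\<in>Poly_Mapping.keys t. x i ^ Poly_Mapping.lookup t i) = (\<Prod>i<k. x i ^ Poly_Mapping.lookup t i)"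
    by (intro prod.mono_neutral_left) (auto simp: in_keys_iff)
qed

section \<open>The maximal digit sum \<open>W_q\<close>\<close>

lemma finite_W_q_set:
  fixes k :: nat
  shows
  "finite {(\<Sum>i<k. digit_sum q (t i)) | t. t \<in> PiE {..<k} (\<lambda>_. {0..q^m - 1}) \<and> (\<Sum>i<k. t i) \<le> d}"
proof -
  have "finite (PiE {..<k} (\<lambda>_. {0..q^m - 1}))" by (intro finite_PiE) auto
  then have "finite ((\<lambda>t. \<Sum>i<k. digit_sum q (t i)) ` PiE {..<k} (\<lambda>_. {0..q^m - 1}))" by (rule finite_imageI)
  then show ?thesis by (rule finite_subset[rotated]) auto
qed

lemma W_q_ge:
  fixes k :: nat
  assumes "\<And>i. i < k \<Longrightarrow> t i \<le> q ^ m - 1" "(\<Sum>i<k. t i) \<le> d"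
  shows "(\<Sum>i<k. digit_sum q (t i)) \<le> W_q q m k d"
  unfolding W_q_def
  by (rule Max_ge[OF finite_W_q_set], rule CollectI, rule exI[of _ "restrict t {..<k}"]) (use assms in auto)

lemma W_q_pos:
  assumes "q \<ge> 2" "m \<ge> 1" "k \<ge> 1" "d \<ge> 1"
  shows "W_q q m k d \<ge> 1"
proof -
  have Q: "q ^ m \<ge> 2" using assms by (simp add: power_ge_2)
  \<comment> \<open>The witness is the exponent vector of a single variable.\<close>
  have "(\<Sum>i<k. digit_sum q (if i = 0 then 1 else 0)) \<le> W_q q m k d"
    using Q assms by (intro W_q_ge) auto
  moreover have "digit_sum q (if i = 0 then 1 else 0) = (if i = (0::nat) then 1 else 0)" for i
    using digit_sum_less[of q 1] assms by simp
  ultimately show ?thesis using assms by simp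
qed

section \<open>Divisibility of the number of points of trace zero\<close>

text \<open>Here \<open>J\<close> is a multinomial index, \<open>v\<close> the valuation of its
  coefficient and \<open>b i\<close> the resulting exponent of variable \<open>i\<close>. The
  hypothesis \<open>C\<close> bounds \<open>C\<close> by the ceiling of
  \<open>m * k / W\<close>.\<close>

lemma multinomial_exponent_bound:
  fixes J :: "nat \<times> 't \<Rightarrow> nat" and u :: "'t \<Rightarrow> nat \<Rightarrow> nat"
  assumes p: "prime p" and e: "e \<ge> 1" and m: "m \<ge> 1" and K: "finite K" and W: "W \<ge> 1"
    and deg: "\<And>t. t \<in> K \<Longrightarrow> (\<Sum>i<k. digit_sum (p ^ e) (u t i)) \<le> W"
    and dvd_sum: "(p ^ e - 1) dvd (\<Sum>s\<in>{..<m} \<times> K. J s)"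
    and b: "\<And>i. b i = (\<Sum>(j, t)\<in>{..<m} \<times> K. J (j, t) * ((p ^ e) ^ j * u t i))"
    and dvd_b: "\<And>i. i < k \<Longrightarrow> ((p ^ e) ^ m - 1) dvd b i"
    and C: "\<And>n. m * k \<le> W * n \<Longrightarrow> C \<le> n"
    and v: "(p - 1) * v + (p - 1) * e = (\<Sum>s\<in>{..<m} \<times> K. digit_sum p (J s))"
  shows "e * C \<le> v + e + e * m * card {i. i < k \<and> b i = 0}"
proof -
  define q where "q = p ^ e"
  have p2: "p \<ge> 2" using prime_ge_2_nat[OF p] .
  then have q: "q \<ge> 2" using e by (simp add: power_ge_2 q_def)
  define z where "z = card {i. i < k \<and> b i = 0}"
  let ?I = "{..<m} \<times> K"
  define Y where "Y l = (\<Sum>s\<in>?I. digit_sum q (p ^ l * J s))" for l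
  \<comment> \<open>Integrality of \<open>y l\<close> is what allows rounding up for each shift
    \<open>l\<close> separately.\<close>
  have "\<exists>y. Y l = (q - 1) * y" for l
  proof -
    have "[Y l = (\<Sum>s\<in>?I. p ^ l * J s)] (mod (q - 1))"
      unfolding Y_def by (intro cong_sum digit_sum_mod[OF q])
    moreover have "(q - 1) dvd (\<Sum>s\<in>?I. p ^ l * J s)"
      using dvd_sum by (simp add: q_def flip: sum_distrib_left)
    ultimately show ?thesis by (metis cong_dvd_iff dvdE)
  qed
  then obtain y where y: "\<And>l. Y l = (q - 1) * y l" by metis
  have "C \<le> y l + m * z" for l
  proof -
    let ?B = "{i. i < k \<and> b i \<noteq> 0}"
    have "{..<k} = ?B \<union> {i. i < k \<and> b i = 0}" by auto
    then have card_B: "k = card ?B + z" unfolding z_def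
      by (metis (no_types, lifting) card_Un_disjoint card_lessThan finite_Un finite_lessThan disjoint_iff mem_Collect_eq)
    have "card ?B * (m * (q - 1)) = (\<Sum>i\<in>?B. m * (q - 1))" by simp
    also have "\<dots> \<le> (\<Sum>i\<in>?B. digit_sum q (p ^ l * b i))"
    proof (rule sum_mono)
      fix i assume "i \<in> ?B"
      then show "m * (q - 1) \<le> digit_sum q (p ^ l * b i)"
        using dvd_b[of i] p2 by (intro digit_sum_ge_of_dvd q m) (auto simp: q_def)
    qed
    also have "\<dots> \<le> (\<Sum>i<k. digit_sum q (p ^ l * b i))"
      by (rule sum_mono2) auto
    also have "\<dots> \<le> (\<Sum>i<k. \<Sum>(j, t)\<in>?I. digit_sum q (p ^ l * J (j, t)) * digit_sum q (u t i))"
    proof (rule sum_mono)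
      fix i
      have "digit_sum q (p ^ l * b i) \<le> (\<Sum>(j, t)\<in>?I. digit_sum q (p ^ l * J (j, t) * (q ^ j * u t i)))"
        unfolding b q_def[symmetric] sum_distrib_left
        using digit_sum_sum_le[OF q, of "\<lambda>s. p ^ l * (case s of (j, t) \<Rightarrow> J (j, t) * (q ^ j * u t i))" ?I]
        by (simp add: case_prod_unfold mult.assoc)
      \<comment> \<open>The Frobenius factor \<open>q ^ j\<close> is a mere shift and drops
        out.\<close>
      also have "\<dots> \<le> (\<Sum>(j, t)\<in>?I. digit_sum q (p ^ l * J (j, t)) * digit_sum q (u t i))"
        using digit_sum_mult_le[OF q] digit_sum_mult_power[OF q]
        by (intro sum_mono) (metis (mono_tags, lifting) case_prod_unfold)
      finally show "digit_sum q (p ^ l * b i) \<le> \<dots>" .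
    qed
    also have "\<dots> = (\<Sum>(j, t)\<in>?I. digit_sum q (p ^ l * J (j, t)) * (\<Sum>i<k. digit_sum q (u t i)))"
      by (subst sum.swap) (simp add: case_prod_unfold sum_distrib_left)
    also have "\<dots> \<le> (\<Sum>(j, t)\<in>?I. digit_sum q (p ^ l * J (j, t)) * W)"
      using deg by (intro sum_mono) (auto simp: q_def)
    also have "\<dots> = (q - 1) * (W * y l)"
    proof -
      have "(\<Sum>(j, t)\<in>?I. digit_sum q (p ^ l * J (j, t)) * W) = Y l * W"
        by (simp add: Y_def case_prod_unfold sum_distrib_right)
      then show ?thesis by (simp add: y mult_ac)
    qed
    finally have "card ?B * m \<le> W * y l"
      using q by (simp add: mult_ac)
    \<comment> \<open>The \<open>z\<close> variables with exponent \<open>0\<close> yield no digit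
      bound. They are credited \<open>m\<close> each, matching the factor \<open>q ^ m\<close> that
      each contributes to the sum over all points.\<close>
    moreover have "m * z \<le> W * (m * z)" using W by simp
    moreover have "m * k = card ?B * m + m * z" using card_B by (metis add_mult_distrib2 mult.commute)
    ultimately have "m * k \<le> W * (y l + m * z)" unfolding add_mult_distrib2 by linarith
    then show ?thesis by (rule C)
  qed
  then have "(\<Sum>l<e. C) \<le> (\<Sum>l<e. y l + m * z)" by (intro sum_mono)
  then have le: "e * C \<le> (\<Sum>l<e. y l) + e * (m * z)" by (simp add: sum.distrib)
  have "(p - 1) * ((q - 1) * (\<Sum>l<e. y l)) = (p - 1) * (\<Sum>l<e. Y l)"
    by (simp add: y sum_distrib_left)
  also have "\<dots> = (\<Sum>s\<in>?I. (p - 1) * (\<Sum>l<e. digit_sum q (p ^ l * J s)))"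
    unfolding Y_def by (subst sum.swap) (simp add: sum_distrib_left)
  also have "\<dots> = (\<Sum>s\<in>?I. (q - 1) * digit_sum p (J s))"
    unfolding q_def by (simp only: sum_digit_sum_shifts[OF p2 e])
  also have "\<dots> = (p - 1) * ((q - 1) * (v + e))"
    unfolding sum_distrib_left[symmetric] v[symmetric] by (simp only: add_mult_distrib2 mult_ac)
  finally have "(\<Sum>l<e. y l) = v + e" using p2 q by simp
  then show ?thesis using le by (simp add: z_def mult.assoc)
qed

context unramified_lift
begin

text \<open>Terms are indexed by \<open>t\<close>, so distinct monomials may share the exponents
  \<open>u t\<close> after reduction. The exponent has \<open>C - 1\<close> because the fibers over
  points of trace zero supply another factor \<open>p ^ e\<close>.\<close>

lemma prime_power_dvd_card_trace_zero:
  fixes u :: "'t \<Rightarrow> nat \<Rightarrow> nat" and c :: "'t \<Rightarrow> 'a"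
  assumes r: "r = e * m" and e: "e \<ge> 1" and m: "m \<ge> 1" and K: "finite K" and W: "W \<ge> 1"
    and deg: "\<And>t. t \<in> K \<Longrightarrow> (\<Sum>i<k. digit_sum (p ^ e) (u t i)) \<le> W"
    and C: "\<And>n. m * k \<le> W * n \<Longrightarrow> C \<le> n"
  shows "p ^ (e * (C - 1)) dvd
    card {x \<in> PiE {..<k} (\<lambda>_. UNIV). trace_sum (p ^ e) m (\<Sum>t\<in>K. c t * (\<Prod>i<k. x i ^ u t i)) = 0}"
proof -
  define q where "q = p ^ e"
  define E where "E = e * (C - 1)"
  \<comment> \<open>The factor \<open>q - 1\<close> turns a nonzero trace into \<open>1\<close>, and
    \<open>p ^ E\<close> lifts this from residues to precision \<open>p ^ E\<close>.\<close>
  define n where "n = (q - 1) * p ^ E"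
  let ?X = "PiE {..<k} (\<lambda>_. UNIV :: 'a set)"
  let ?I = "{..<m} \<times> K"
  define F where "F x = (\<Sum>t\<in>K. c t * (\<Prod>i<k. x i ^ u t i))" for x
  define a where "a x = (\<lambda>(j, t). teich E (c t) ^ (q ^ j) * (\<Prod>i<k. teich E (x i) ^ (q ^ j * u t i)))" for x
  define A where "A x = (\<Sum>s\<in>?I. a x s)" for x
  have finX: "finite ?X" by (intro finite_PiE) auto
  have p2: "p \<ge> 2" using prime_ge_2_nat[OF prime_p] .
  then have q: "q \<ge> 2" using e by (simp add: power_ge_2 q_def)
  have card: "card (UNIV :: 'a set) = (p ^ e) ^ m" using card_field r by (simp add: power_mult)
  have CHAR: "CHAR('a) = p" using CHAR_eq_of_card[OF prime_p card_field] .

  have \<phi>_A: "\<phi> (A x) = trace_sum q m (F x)" for x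
  proof -
    have "(c t * (\<Prod>i<k. x i ^ u t i)) ^ (q ^ j) = c t ^ (q ^ j) * (\<Prod>i<k. x i ^ (q ^ j * u t i))" for j t
      by (simp add: power_mult_distrib prod_power_distrib mult.commute flip: power_mult)
    then have "\<phi> (A x) = (\<Sum>(j, t)\<in>?I. (c t * (\<Prod>i<k. x i ^ u t i)) ^ (q ^ j))"
      unfolding A_def a_def \<phi>_sum
      by (intro sum.cong) (auto simp: \<phi>_mult \<phi>_power \<phi>_prod \<phi>_teich)
    also have "\<dots> = (\<Sum>j<m. \<Sum>t\<in>K. (c t * (\<Prod>i<k. x i ^ u t i)) ^ (q ^ j))"
      by (simp add: sum.cartesian_product)
    also have "\<dots> = trace_sum q m (F x)"
      unfolding trace_sum_def F_def
    proof (intro sum.cong refl)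
      fix j
      have "q ^ j = CHAR('a) ^ (e * j)" by (simp add: q_def CHAR power_mult)
      then show "(\<Sum>t\<in>K. (c t * (\<Prod>i<k. x i ^ u t i)) ^ (q ^ j)) = (\<Sum>t\<in>K. c t * (\<Prod>i<k. x i ^ u t i)) ^ (q ^ j)"
        using prime_p CHAR by (intro freshmans_dream_sum'[symmetric]) auto
    qed
    finally show ?thesis .
  qed

  have indicator: "D E (A x ^ n - (if trace_sum q m (F x) = 0 then 0 else 1))" for x
  proof (cases "trace_sum q m (F x) = 0")
    case True
    then have "\<phi> (A x ^ (q - 1)) = \<phi> 0" using q by (simp add: \<phi>_power \<phi>_A \<phi>_0)
    from D_power_prime_power_diff[OF this, of E] show ?thesis
      using True p2 by (auto dest!: D_Suc simp: n_def power_mult power_0_left)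
  next
    case False
    have "trace_sum q m (F x) ^ q = trace_sum q m (F x)"
      unfolding q_def by (rule trace_sum_power[OF prime_p card])
    then have "trace_sum q m (F x) * trace_sum q m (F x) ^ (q - 1) = trace_sum q m (F x) * 1"
      using q by (simp flip: power_Suc)
    then have "\<phi> (A x ^ (q - 1)) = \<phi> 1" using False by (simp add: \<phi>_power \<phi>_A \<phi>_1)
    from D_power_prime_power_diff[OF this, of E] show ?thesis
      using False by (auto dest!: D_Suc simp: n_def power_mult)
  qed

  \<comment> \<open>This digit sum is independent of \<open>E\<close>, so the valuation of the
    multinomial coefficients loses only \<open>e\<close>, however high the precision.\<close>
  have digit_n: "digit_sum p n = (p - 1) * e"
    unfolding n_def q_def using digit_sum_mult_power[OF p2, of E "p ^ e - 1"] digit_sum_power_minus_1[OF p2, of e]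
    by (simp add: mult.commute)

  have sum_A: "D E (\<Sum>x\<in>?X. A x ^ n)"
  proof -
    let ?J = "{J. J \<in> ?I \<rightarrow>\<^sub>E {..n} \<and> sum J ?I = n}"
    have "finite ?I" using K by simp
    then obtain w where w:
      "\<And>a :: nat \<times> 't \<Rightarrow> 'r. (\<Sum>s\<in>?I. a s) ^ n = (\<Sum>J\<in>?J. of_nat (w J) * (\<Prod>s\<in>?I. a s ^ J s))"
      "\<And>J. J \<in> ?I \<rightarrow>\<^sub>E {..n} \<Longrightarrow> sum J ?I = n \<Longrightarrow> w J * (\<Prod>s\<in>?I. fact (J s)) = fact n"
      by (rule multinomial_expansion[where n = n]) (rule that; blast)
    have "D E (\<Sum>x\<in>?X. of_nat (w J) * (\<Prod>s\<in>?I. a x s ^ J s))" if J: "J \<in> ?J" for J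
    proof -
      define b where "b i = (\<Sum>(j, t)\<in>?I. J (j, t) * (q ^ j * u t i))" for i
      define v where "v = multiplicity p (w J)"
      let ?c = "\<Prod>(j, t)\<in>?I. (teich E (c t) ^ (q ^ j)) ^ J (j, t)"
      have "(\<Prod>s\<in>?I. a x s ^ J s) = ?c * (\<Prod>i<k. teich E (x i) ^ b i)" for x
      proof -
        have "(\<Prod>s\<in>?I. a x s ^ J s) = ?c * (\<Prod>(j, t)\<in>?I. \<Prod>i<k. teich E (x i) ^ (J (j, t) * (q ^ j * u t i)))"
          by (simp add: a_def case_prod_unfold power_mult_distrib prod.distrib prod_power_distrib mult.commute flip: power_mult)
        also have "(\<Prod>(j, t)\<in>?I. \<Prod>i<k. teich E (x i) ^ (J (j, t) * (q ^ j * u t i))) = (\<Prod>i<k. teich E (x i) ^ b i)"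
          unfolding b_def power_sum case_prod_unfold by (rule prod.swap)
        finally show ?thesis .
      qed
      then have eq: "(\<Sum>x\<in>?X. of_nat (w J) * (\<Prod>s\<in>?I. a x s ^ J s)) =
          ?c * (of_nat (w J) * (\<Sum>x\<in>?X. \<Prod>i<k. teich E (x i) ^ b i))"
        unfolding sum_distrib_left by (intro sum.cong refl) (simp only: mult_ac)
      have v: "(p - 1) * v + (p - 1) * e = (\<Sum>s\<in>?I. digit_sum p (J s))"
        using multiplicity_multinomial[OF prime_p _ w(2)[of J]] J K digit_n by (simp add: v_def)
      \<comment> \<open>The coefficient already supplies \<open>p ^ v\<close>; truncated subtraction
        asks nothing of the power sums when \<open>v\<close> exceeds \<open>E\<close>.\<close>
      have "E - v \<le> r * card {i. i < k \<and> b i = 0}" if dvd: "\<And>i. i < k \<Longrightarrow> (p ^ r - 1) dvd b i"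
      proof -
        have "e * C \<le> v + e + e * m * card {i. i < k \<and> b i = 0}"
        proof (rule multinomial_exponent_bound[OF prime_p e m K W deg _ _ _ C v])
          show "(p ^ e - 1) dvd (\<Sum>s\<in>?I. J s)" using J by (simp add: n_def q_def)
        qed (use dvd r in \<open>simp_all add: b_def q_def power_mult\<close>)
        then show ?thesis by (simp add: E_def r diff_mult_distrib2)
      qed
      then have "D (E - v) (\<Sum>x\<in>?X. \<Prod>i<k. teich E (x i) ^ b i)"
        by (rule D_sum_teich_monomial) auto
      moreover have "D v (of_nat (w J))"
      proof -
        obtain l where "w J = p ^ v * l" using multiplicity_dvd[of p "w J"] by (auto simp: v_def elim: dvdE)
        then show ?thesis using D_mult_right[OF D_power_p] by simp
      qed
      ultimately have "D (v + (E - v)) (of_nat (w J) * (\<Sum>x\<in>?X. \<Prod>i<k. teich E (x i) ^ b i))"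
        by (intro D_mult)
      then have "D E (of_nat (w J) * (\<Sum>x\<in>?X. \<Prod>i<k. teich E (x i) ^ b i))"
        by (rule D_mono[rotated]) simp
      then show ?thesis unfolding eq by (rule D_mult_left)
    qed
    then have "D E (\<Sum>J\<in>?J. \<Sum>x\<in>?X. of_nat (w J) * (\<Prod>s\<in>?I. a x s ^ J s))" by (rule D_sum)
    then show ?thesis unfolding A_def w(1) by (subst sum.swap)
  qed

  \<comment> \<open>This makes the number of all points, \<open>p ^ (e * (m * k))\<close>, divisible
    by \<open>p ^ E\<close>.\<close>
  have "C \<le> m * k" using W by (intro C) simp
  then have "E \<le> e * (m * k)" unfolding E_def by (intro mult_le_mono2) simp
  then have "D E (of_nat (p ^ (e * (m * k))))" using D_power_p by (rule D_mono)
  then have "D E (\<Sum>x\<in>?X. 1)"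
    by (simp add: card_PiE card power_mult)
  moreover have "D E (\<Sum>x\<in>?X. A x ^ n - (if trace_sum q m (F x) = 0 then 0 else 1))"
    by (intro D_sum indicator)
  \<comment> \<open>Points of trace zero are all points minus those of nonzero trace, whose number
    is congruent to the sum of \<open>A x ^ n\<close>.\<close>
  ultimately have "D E ((\<Sum>x\<in>?X. A x ^ n - (if trace_sum q m (F x) = 0 then 0 else 1)) - (\<Sum>x\<in>?X. A x ^ n) + (\<Sum>x\<in>?X. 1))"
    using sum_A by (intro D_add D_diff)
  also have "(\<Sum>x\<in>?X. A x ^ n - (if trace_sum q m (F x) = 0 then 0 else 1)) - (\<Sum>x\<in>?X. A x ^ n) + (\<Sum>x\<in>?X. 1)
      = (\<Sum>x\<in>?X. if trace_sum q m (F x) = 0 then 1 else 0)"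
    unfolding sum_subtractf[symmetric] sum.distrib[symmetric] by (intro sum.cong) auto
  also have "\<dots> = of_int (int (card {x \<in> ?X. trace_sum q m (F x) = 0}))"
    using finX by (simp add: sum.If_cases Int_def)
  finally have "D E (of_int (int (card {x \<in> ?X. trace_sum q m (F x) = 0})))" .
  then have "int (p ^ E) dvd int (card {x \<in> ?X. trace_sum q m (F x) = 0})" by (rule D_of_int)
  then show ?thesis by (simp add: E_def F_def q_def flip: of_nat_power)
qed

end

text \<open>Stating the valuation bound as divisibility also covers the case without
  solutions.\<close>

theorem theorem5p6:
  fixes p e m k d :: nat and f :: "(nat \<Rightarrow>\<^sub>0 nat) \<Rightarrow>\<^sub>0 'a::{field,finite}"
  assumes "prime p" and "e \<ge> 1" and "m \<ge> 1" and "k \<ge> 1"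
    and "card (UNIV :: 'a set) = (p ^ e) ^ m"
    and "vars_below k f"
    and "total_degree f = d" and "d \<ge> 1"
  shows "p ^ (e * nat \<lceil>real (m * k) / real (W_q (p ^ e) m k d)\<rceil>) dvd N_AS (p ^ e) k f"
proof -
  define W where "W = W_q (p ^ e) m k d"
  define C where "C = nat \<lceil>real (m * k) / real W\<rceil>"
  have q: "p ^ e \<ge> 2" using prime_ge_2_nat[OF assms(1)] assms(2) by (simp add: power_ge_2)
  have W: "W \<ge> 1" unfolding W_def using q assms by (intro W_q_pos)
  \<comment> \<open>The universal property of the ceiling, in the form required above.\<close>
  have C: "C \<le> n" if "m * k \<le> W * n" for n
  proof -
    have "real (m * k) \<le> real W * real n" using that by (metis of_nat_le_iff of_nat_mult)
    then have "real (m * k) / real W \<le> real n" using W by (simp add: divide_le_eq mult.commute)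
    then show ?thesis unfolding C_def by (simp add: ceiling_le_iff nat_le_iff)
  qed
  have "C \<ge> 1" using W assms(3,4) by (simp add: C_def Suc_le_eq)
  define Q where "Q = card (UNIV :: 'a set)"
  have Q: "Q > 1" unfolding Q_def by (rule card_field_gt_1)
  have card: "card (UNIV :: 'a set) = p ^ (e * m)" using assms(5) by (simp add: power_mult)
  \<comment> \<open>Reduction puts the exponents into the range allowed in \<open>W_q\<close>
    without raising the degree.\<close>
  define u where "u t i = reduce_exponent Q (Poly_Mapping.lookup t i)" for t :: "nat \<Rightarrow>\<^sub>0 nat" and i
  have deg: "(\<Sum>i<k. digit_sum (p ^ e) (u t i)) \<le> W" if t: "t \<in> Poly_Mapping.keys f" for t
    unfolding W_def
  proof (rule W_q_ge)
    show "u t i \<le> (p ^ e) ^ m - 1" for i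
      using reduce_exponent_le_minus_1[OF Q] assms(5) by (simp add: u_def Q_def)
    have "(\<Sum>i<k. u t i) \<le> (\<Sum>i<k. Poly_Mapping.lookup t i)"
      unfolding u_def by (intro sum_mono reduce_exponent_le)
    also have "\<dots> = mon_deg t"
      unfolding mon_deg_def using t assms(6)
      by (intro sum.mono_neutral_right) (auto simp: vars_below_def in_keys_iff)
    also have "\<dots> \<le> d"
      unfolding assms(7)[symmetric] total_degree_def using t by (intro Max_ge) auto
    finally show "(\<Sum>i<k. u t i) \<le> d" .
  qed
  obtain D :: "nat \<Rightarrow> int poly \<Rightarrow> bool" and \<phi> :: "int poly \<Rightarrow> 'a" where "unramified_lift p (e * m) D \<phi>"
    using exists_unramified_lift[OF assms(1) card] .
  then interpret unramified_lift p "e * m" D \<phi> .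
  have "p ^ (e * (C - 1)) dvd card {x \<in> PiE {..<k} (\<lambda>_. UNIV). trace_sum (p ^ e) m (mpeval f x) = 0}"
    using prime_power_dvd_card_trace_zero[OF refl assms(2,3) _ W deg C, where K = "Poly_Mapping.keys f" and c = "Poly_Mapping.lookup f"]
    by (simp add: mpeval_reduce[OF assms(6)] u_def Q_def)
  then have "p ^ e * p ^ (e * (C - 1)) dvd N_AS (p ^ e) k f"
    unfolding N_AS_eq[OF assms(1-3,5)] by (rule mult_dvd_mono[OF dvd_refl])
  moreover have "e * C = e + e * (C - 1)" using \<open>C \<ge> 1\<close> by (cases C) auto
  ultimately show ?thesis unfolding C_def[symmetric] W_def[symmetric] by (simp add: power_add)
qed

end
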